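(* Let $k$ be a field, $V$ a finite-dimensional $k$-vector space and $b:V\times V\to k$ an anisotropic symmetric $k$-bilinear form. Then the right-invariant order on $\mathrm{PPU}(b)$ with positive cone $\mathrm{PPU}(b)^+$, i.e. $\varphi\le\psi:\Leftrightarrow \psi\varphi^{-1}\in\mathrm{PPU}(b)^+$, is a lattice-order (any two elements have a supremum and an infimum).
   Context: Anisotropic means $b(v,v)=0\Leftrightarrow v=0$. Let $V[t,t^{-1}]:=k[t,t^{-1}]\otimes_k V$; its elements are finite sums $v=\sum_{i\in\mathbb Z}t^iv_i$ with $v_i\in V$. Define $\tilde b(v,w)=\sum_{n\in\mathbb Z} t^n\big(\sum_{i\in\mathbb Z} b(v_{i-n},w_i)\big)\in k[t,t^{-1}]$. Each $\varphi\in \mathrm{End}_{k[t,t^{-1}]}V[t,t^{-1}]$ is uniquely a finite sum $\varphi=\sum_i t^i\varphi_i$ with $\varphi_i\in\mathrm{End}_kV$; put $\varphi(1)=\sum_i\varphi_i$. The paraunitary group $\mathrm{PU}(b)$ is the group of all $k[t,t^{-1}]$-linear automorphisms $\varphi$ of $V[t,t^{-1}]$ with $\tilde b(\varphi(v),\varphi(w))=\tilde b(v,w)$ for all $v,w$. The pure paraunitary group is $\mathrm{PPU}(b)=\{\varphi\in \mathrm{PU}(b):\varphi(1)=\mathrm{id}_V\}$. $\mathrm{PPU}(b)^+$ is the submonoid of those $\varphi\in\mathrm{PPU}(b)$ with $\varphi_i=0$ for all $i<0$. *)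

theory Defs
  imports Complex_Main "HOL-Library.Poly_Mapping" "HOL-Algebra.Group"
begin

text \<open>
  The space \<open>V\<close> is a type \<^typ>\<open>'v\<close> with a scalar multiplication \<open>scale\<close> over the field \<^typ>\<open>'k\<close>.
  Finitely supported functions on \<^typ>\<open>int\<close> serve both as \<open>k[t,t\<inverse>]\<close>, where the ring
  multiplication is the library's convolution product, and as \<open>V[t,t\<inverse>]\<close>;
  \<open>Poly_Mapping.single i a\<close> is \<open>t\<^sup>i a\<close>.
\<close>

type_synonym 'a laurent = "int \<Rightarrow>\<^sub>0 'a"

definition lscale ::
  "('k::field \<Rightarrow> 'v::ab_group_add \<Rightarrow> 'v) \<Rightarrow> 'k laurent \<Rightarrow> 'v laurent \<Rightarrow> 'v laurent" where
  "lscale scale p v =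
    (\<Sum>i\<in>Poly_Mapping.keys p. \<Sum>j\<in>Poly_Mapping.keys v. Poly_Mapping.single (i + j) (scale (Poly_Mapping.lookup p i) (Poly_Mapping.lookup v j)))"

text \<open>For bilinear \<open>b\<close> both sums below have finite support, as \<^const>\<open>Sum_any\<close> requires.\<close>

definition btilde ::
  "('v::ab_group_add \<Rightarrow> 'v \<Rightarrow> 'k::field) \<Rightarrow> 'v laurent \<Rightarrow> 'v laurent \<Rightarrow> 'k laurent" where
  "btilde b v w =
    Sum_any (\<lambda>n. Poly_Mapping.single n (Sum_any (\<lambda>i. b (Poly_Mapping.lookup v (i - n)) (Poly_Mapping.lookup w i))))"

definition symmetric_bilinear ::
  "('k::field \<Rightarrow> 'v::ab_group_add \<Rightarrow> 'v) \<Rightarrow> ('v \<Rightarrow> 'v \<Rightarrow> 'k) \<Rightarrow> bool" where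
  "symmetric_bilinear scale b \<longleftrightarrow>
    (\<forall>v. Vector_Spaces.linear scale (*) (\<lambda>w. b v w)) \<and>
    (\<forall>w. Vector_Spaces.linear scale (*) (\<lambda>v. b v w)) \<and>
    (\<forall>v w. b v w = b w v)"

definition anisotropic :: "('v::ab_group_add \<Rightarrow> 'v \<Rightarrow> 'k::field) \<Rightarrow> bool" where
  "anisotropic b \<longleftrightarrow> (\<forall>v. b v v = 0 \<longleftrightarrow> v = 0)"

text \<open>
  The coefficient \<open>\<phi>\<^sub>i\<close> is read off from the values of \<open>\<phi>\<close> on constants; that
  \<open>\<phi> = \<Sum>\<^sub>i t\<^sup>i \<phi>\<^sub>i\<close> is a finite sum and determines the \<open>\<phi>\<^sub>i\<close> is shown in
  \<open>hom_coeff_expansion\<close>, \<open>finite_hom_coeff\<close> and \<open>hom_coeff_unique\<close>.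
\<close>

definition hom_coeff ::
  "('v::ab_group_add laurent \<Rightarrow> 'v laurent) \<Rightarrow> int \<Rightarrow> 'v \<Rightarrow> 'v" where
  "hom_coeff \<phi> i v = Poly_Mapping.lookup (\<phi> (Poly_Mapping.single 0 v)) i"

definition at_one :: "('v::ab_group_add laurent \<Rightarrow> 'v laurent) \<Rightarrow> 'v \<Rightarrow> 'v" where
  "at_one \<phi> v = Sum_any (\<lambda>i. hom_coeff \<phi> i v)"

definition PU ::
  "('k::field \<Rightarrow> 'v::ab_group_add \<Rightarrow> 'v) \<Rightarrow> ('v \<Rightarrow> 'v \<Rightarrow> 'k) \<Rightarrow> ('v laurent \<Rightarrow> 'v laurent) set" where
  "PU scale b = {\<phi>. module_hom (lscale scale) (lscale scale) \<phi> \<and> bij \<phi> \<and>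
    (\<forall>v w. btilde b (\<phi> v) (\<phi> w) = btilde b v w)}"

definition PPU ::
  "('k::field \<Rightarrow> 'v::ab_group_add \<Rightarrow> 'v) \<Rightarrow> ('v \<Rightarrow> 'v \<Rightarrow> 'k) \<Rightarrow> ('v laurent \<Rightarrow> 'v laurent) set" where
  "PPU scale b = {\<phi> \<in> PU scale b. at_one \<phi> = id}"

definition PPU_pos ::
  "('k::field \<Rightarrow> 'v::ab_group_add \<Rightarrow> 'v) \<Rightarrow> ('v \<Rightarrow> 'v \<Rightarrow> 'k) \<Rightarrow> ('v laurent \<Rightarrow> 'v laurent) set" where
  "PPU_pos scale b = {\<phi> \<in> PPU scale b. \<forall>i<0. hom_coeff \<phi> i = (\<lambda>_. 0)}"

definition PU_group ::
  "('k::field \<Rightarrow> 'v::ab_group_add \<Rightarrow> 'v) \<Rightarrow> ('v \<Rightarrow> 'v \<Rightarrow> 'k) \<Rightarrow> ('v laurent \<Rightarrow> 'v laurent) monoid" where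
  "PU_group scale b = \<lparr>carrier = PU scale b, mult = (\<circ>), one = id\<rparr>"

definition PPU_group ::
  "('k::field \<Rightarrow> 'v::ab_group_add \<Rightarrow> 'v) \<Rightarrow> ('v \<Rightarrow> 'v \<Rightarrow> 'k) \<Rightarrow> ('v laurent \<Rightarrow> 'v laurent) monoid" where
  "PPU_group scale b = (PU_group scale b)\<lparr>carrier := PPU scale b\<rparr>"

definition PPU_order ::
  "('k::field \<Rightarrow> 'v::ab_group_add \<Rightarrow> 'v) \<Rightarrow> ('v \<Rightarrow> 'v \<Rightarrow> 'k) \<Rightarrow> ('v laurent \<Rightarrow> 'v laurent) gorder" where
  "PPU_order scale b = \<lparr>carrier = PPU scale b, eq = (=),
    le = (\<lambda>\<phi> \<psi>. \<psi> \<otimes>\<^bsub>PPU_group scale b\<^esub> inv\<^bsub>PPU_group scale b\<^esub> \<phi> \<in> PPU_pos scale b)\<rparr>"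

lemma laurent_induct [case_names zero single add]:
  fixes p :: "'a::comm_monoid_add laurent"
  assumes "P 0" "\<And>i a. P (Poly_Mapping.single i a)" "\<And>p q. P p \<Longrightarrow> P q \<Longrightarrow> P (p + q)"
  shows "P p"
proof -
  have "P (\<Sum>i\<in>A. Poly_Mapping.single i (Poly_Mapping.lookup p i))" if "finite A" for A
    using that by (induction A rule: finite_induct) (auto simp: assms)
  moreover have "(\<Sum>i\<in>Poly_Mapping.keys p. Poly_Mapping.single i (Poly_Mapping.lookup p i)) = p"
  proof (rule poly_mapping_eqI)
    fix n
    show "Poly_Mapping.lookup (\<Sum>i\<in>Poly_Mapping.keys p. Poly_Mapping.single i (Poly_Mapping.lookup p i)) n = Poly_Mapping.lookup p n"
      by (simp add: lookup_sum lookup_single when_def in_keys_iff)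
  qed
  ultimately show ?thesis
    by (metis finite_keys)
qed

context vector_space
begin

lemma lookup_lscale_superset:
  assumes "finite A" "Poly_Mapping.keys p \<subseteq> A"
  shows "Poly_Mapping.lookup (lscale scale p v) n = (\<Sum>i\<in>A. scale (Poly_Mapping.lookup p i) (Poly_Mapping.lookup v (n - i)))"
proof -
  have "Poly_Mapping.lookup (lscale scale p v) n
      = (\<Sum>i\<in>Poly_Mapping.keys p. \<Sum>j\<in>Poly_Mapping.keys v. if j = n - i then scale (Poly_Mapping.lookup p i) (Poly_Mapping.lookup v j) else 0)"
    unfolding lscale_def lookup_sum
    by (intro sum.cong refl) (auto simp: lookup_single when_def)
  also have "\<dots> = (\<Sum>i\<in>Poly_Mapping.keys p. scale (Poly_Mapping.lookup p i) (Poly_Mapping.lookup v (n - i)))"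
    by (intro sum.cong refl) (auto simp: in_keys_iff)
  also have "\<dots> = (\<Sum>i\<in>A. scale (Poly_Mapping.lookup p i) (Poly_Mapping.lookup v (n - i)))"
    using assms by (intro sum.mono_neutral_left) (auto simp: in_keys_iff)
  finally show ?thesis .
qed

lemma lookup_lscale:
  "Poly_Mapping.lookup (lscale scale p v) n = (\<Sum>i\<in>Poly_Mapping.keys p. scale (Poly_Mapping.lookup p i) (Poly_Mapping.lookup v (n - i)))"
  by (rule lookup_lscale_superset) auto

lemma lookup_lscale_single:
  "Poly_Mapping.lookup (lscale scale (Poly_Mapping.single i a) v) n = scale a (Poly_Mapping.lookup v (n - i))"
  by (subst lookup_lscale_superset[of "{i}"]) auto

lemma lscale_single_single:
  "lscale scale (Poly_Mapping.single i a) (Poly_Mapping.single j v) = Poly_Mapping.single (i + j) (scale a v)"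
  by (rule poly_mapping_eqI) (auto simp: lookup_lscale_single lookup_single when_def)

lemma lscale_add_right: "lscale scale p (v + w) = lscale scale p v + lscale scale p w"
  by (rule poly_mapping_eqI) (simp add: lookup_lscale lookup_add scale_right_distrib sum.distrib)

lemma lscale_add_left: "lscale scale (p + q) v = lscale scale p v + lscale scale q v"
proof (rule poly_mapping_eqI)
  fix n
  have K: "finite (Poly_Mapping.keys p \<union> Poly_Mapping.keys q)" "Poly_Mapping.keys (p + q) \<subseteq> Poly_Mapping.keys p \<union> Poly_Mapping.keys q" by (auto simp: keys_add)
  show "Poly_Mapping.lookup (lscale scale (p + q) v) n = Poly_Mapping.lookup (lscale scale p v + lscale scale q v) n"
    using lookup_lscale_superset[OF K] lookup_lscale_superset[OF K(1), of p]
      lookup_lscale_superset[OF K(1), of q]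
    by (simp add: lookup_add scale_left_distrib sum.distrib)
qed

lemma lscale_zero_left: "lscale scale 0 v = 0"
  by (simp add: lscale_def)

lemma lscale_zero_right: "lscale scale p 0 = 0"
  by (simp add: lscale_def)

lemma lscale_lscale: "lscale scale p (lscale scale q v) = lscale scale (p * q) v"
proof (induction p rule: laurent_induct)
  case (single i a)
  show ?case
  proof (induction q rule: laurent_induct)
    case (single j c)
    show ?case
      by (rule poly_mapping_eqI) (simp add: mult_single lookup_lscale_single diff_diff_eq)
  qed (simp_all add: lscale_zero_left lscale_zero_right lscale_add_left lscale_add_right distrib_left)
qed (simp_all add: lscale_zero_left lscale_add_left distrib_right)

lemma module_lscale: "module (lscale scale)"
proof
  show "lscale scale 1 v = v" for v
    by (rule poly_mapping_eqI) (metis lookup_lscale_single scale_one single_one diff_zero)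
qed (simp_all add: lscale_lscale lscale_add_left lscale_add_right)

lemma hom_single:
  assumes "module_hom (lscale scale) (lscale scale) \<phi>"
  shows "Poly_Mapping.lookup (\<phi> (Poly_Mapping.single j v)) n = hom_coeff \<phi> (n - j) v"
proof -
  have "Poly_Mapping.single j v = lscale scale (Poly_Mapping.single j 1) (Poly_Mapping.single 0 v)"
    by (simp add: lscale_single_single)
  then have "\<phi> (Poly_Mapping.single j v)
      = lscale scale (Poly_Mapping.single j 1) (\<phi> (Poly_Mapping.single 0 v))"
    by (simp add: module_hom.scale[OF assms])
  then show ?thesis
    by (simp add: lookup_lscale_single hom_coeff_def)
qed

lemma linear_hom_coeff:
  assumes "module_hom (lscale scale) (lscale scale) \<phi>"
  shows "Vector_Spaces.linear scale scale (hom_coeff \<phi> i)"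
proof -
  have "hom_coeff \<phi> i (v + w) = hom_coeff \<phi> i v + hom_coeff \<phi> i w" for v w
    by (simp add: hom_coeff_def single_add module_hom.add[OF assms] lookup_add)
  moreover have "hom_coeff \<phi> i (scale a v) = scale a (hom_coeff \<phi> i v)" for a v
  proof -
    have "Poly_Mapping.single 0 (scale a v) = lscale scale (Poly_Mapping.single 0 a) (Poly_Mapping.single 0 v)"
      by (simp add: lscale_single_single)
    then show ?thesis
      by (simp add: hom_coeff_def module_hom.scale[OF assms] lookup_lscale_single)
  qed
  ultimately show ?thesis
    by (intro Vector_Spaces.linear.intro module_hom.intro module_hom_axioms.intro)
      (simp_all add: module_axioms vector_space_axioms)
qed

lemma lookup_hom:
  assumes "module_hom (lscale scale) (lscale scale) \<phi>"
  shows "Poly_Mapping.lookup (\<phi> v) n = (\<Sum>j\<in>Poly_Mapping.keys v. hom_coeff \<phi> (n - j) (Poly_Mapping.lookup v j))"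
proof -
  interpret h: module_hom "lscale scale" "lscale scale" \<phi> by fact
  have "(\<Sum>j\<in>Poly_Mapping.keys v. Poly_Mapping.single j (Poly_Mapping.lookup v j)) = v"
    by (rule poly_mapping_eqI) (simp add: lookup_sum lookup_single when_def in_keys_iff)
  then have "\<phi> v = (\<Sum>j\<in>Poly_Mapping.keys v. \<phi> (Poly_Mapping.single j (Poly_Mapping.lookup v j)))"
    by (metis h.sum)
  then show ?thesis
    by (simp add: lookup_sum hom_single[OF assms])
qed

lemma lookup_expansion:
  assumes "\<And>i. f i 0 = 0"
    and fin: "finite {i. f i \<noteq> (\<lambda>_. 0)}"
  shows "Poly_Mapping.lookup (Sum_any (\<lambda>i. lscale scale (Poly_Mapping.single i 1) (Poly_Mapping.map (f i) v))) n
    = (\<Sum>i | f i \<noteq> (\<lambda>_. 0). f i (Poly_Mapping.lookup v (n - i)))"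
proof -
  let ?g = "\<lambda>i. lscale scale (Poly_Mapping.single i 1) (Poly_Mapping.map (f i) v)"
  have g: "Poly_Mapping.lookup (?g i) n = f i (Poly_Mapping.lookup v (n - i))" for i n
    using assms(1) by (simp add: lookup_lscale_single map.rep_eq when_def)
  have "?g i = 0" if "f i = (\<lambda>_. 0)" for i
    using g that by (metis lookup_zero poly_mapping_eqI)
  then have "Sum_any ?g = (\<Sum>i | f i \<noteq> (\<lambda>_. 0). ?g i)"
    by (intro Sum_any.expand_superset fin) auto
  then show ?thesis
    by (simp add: lookup_sum g)
qed

lemma hom_coeff_unique:
  assumes lin: "\<And>i. Vector_Spaces.linear scale scale (f i)"
    and fin: "finite {i. f i \<noteq> (\<lambda>_. 0)}"
    and \<phi>: "\<And>v. \<phi> v = Sum_any (\<lambda>i. lscale scale (Poly_Mapping.single i 1) (Poly_Mapping.map (f i) v))"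
  shows "hom_coeff \<phi> = f"
proof (intro ext)
  fix i v
  have 0: "f i 0 = 0" for i
    using lin by (rule module_hom.zero[OF Vector_Spaces.linear.axioms(3)])
  have "hom_coeff \<phi> i v = (\<Sum>j | f j \<noteq> (\<lambda>_. 0). f j (v when 0 = i - j))"
    unfolding hom_coeff_def \<phi> by (simp only: lookup_expansion[OF 0 fin] lookup_single)
  also have "\<dots> = (\<Sum>j | f j \<noteq> (\<lambda>_. 0). if j = i then f j v else 0)"
    by (intro sum.cong refl) (auto simp: when_def 0)
  also have "\<dots> = f i v"
    using fin by auto
  finally show "hom_coeff \<phi> i v = f i v" .
qed

lemma Sum_any_lookup_hom:
  assumes h: "module_hom (lscale scale) (lscale scale) \<phi>"
  shows "Sum_any (Poly_Mapping.lookup (\<phi> v)) = at_one \<phi> (Sum_any (Poly_Mapping.lookup v))"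
proof -
  interpret h: module_hom "lscale scale" "lscale scale" \<phi> by fact
  have at_one: "at_one \<phi> v = Sum_any (Poly_Mapping.lookup (\<phi> (Poly_Mapping.single 0 v)))" for v
    by (simp add: at_one_def hom_coeff_def)
  have Sum_any_add: "Sum_any (Poly_Mapping.lookup (p + q)) = Sum_any (Poly_Mapping.lookup p) + Sum_any (Poly_Mapping.lookup q)" for p q :: "'b laurent"
    unfolding lookup_add by (rule Sum_any.distrib) simp_all
  show ?thesis
  proof (induction v rule: laurent_induct)
    case zero
    show ?case by (simp add: at_one h.zero)
  next
    case (single j v)
    have "Sum_any (Poly_Mapping.lookup (\<phi> (Poly_Mapping.single j v))) = Sum_any (\<lambda>n. hom_coeff \<phi> (n - j) v)"
      by (simp add: hom_single[OF h])
    also have "\<dots> = at_one \<phi> v"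
      unfolding at_one_def
      by (rule Sum_any.reindex_cong[of "\<lambda>n. n + j"]) (auto simp: bij_def surj_def intro: exI[of _ "_ - j"])
    finally show ?case
      by (simp add: lookup_single)
  next
    case (add p q)
    then show ?case
      by (simp add: at_one Sum_any_add h.add single_add)
  qed
qed

end

context finite_dimensional_vector_space
begin

lemma finite_hom_coeff:
  assumes h: "module_hom (lscale scale) (lscale scale) \<phi>"
  shows "finite {i. hom_coeff \<phi> i \<noteq> (\<lambda>_. 0)}"
proof (rule finite_subset)
  interpret vector_space_pair scale scale by unfold_locales
  show "{i. hom_coeff \<phi> i \<noteq> (\<lambda>_. 0)} \<subseteq> (\<Union>v\<in>Basis. Poly_Mapping.keys (\<phi> (Poly_Mapping.single 0 v)))"
  proof (rule subsetI, rule ccontr)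
    fix i assume "i \<in> {i. hom_coeff \<phi> i \<noteq> (\<lambda>_. 0)}"
      and i: "i \<notin> (\<Union>v\<in>Basis. Poly_Mapping.keys (\<phi> (Poly_Mapping.single 0 v)))"
    moreover have "hom_coeff \<phi> i v = 0" for v
    proof (rule linear_eq_0_on_span[OF linear_hom_coeff[OF h]])
      show "v \<in> span Basis" by (simp add: span_Basis)
      show "hom_coeff \<phi> i w = 0" if "w \<in> Basis" for w
        using that i by (auto simp: hom_coeff_def in_keys_iff)
    qed
    ultimately show False by auto
  qed
qed (simp add: finite_Basis)

lemma hom_coeff_expansion:
  assumes h: "module_hom (lscale scale) (lscale scale) \<phi>"
  shows "\<phi> v = Sum_any (\<lambda>i. lscale scale (Poly_Mapping.single i 1) (Poly_Mapping.map (hom_coeff \<phi> i) v))"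
proof (rule poly_mapping_eqI)
  fix n
  note 0 = module_hom.zero[OF Vector_Spaces.linear.axioms(3)[OF linear_hom_coeff[OF h]]]
  let ?S = "{i. hom_coeff \<phi> i \<noteq> (\<lambda>_. 0)}"
  have "Poly_Mapping.lookup (\<phi> v) n = (\<Sum>j\<in>Poly_Mapping.keys v. hom_coeff \<phi> (n - j) (Poly_Mapping.lookup v j))"
    by (rule lookup_hom[OF h])
  also have "\<dots> = (\<Sum>j\<in>Poly_Mapping.keys v \<union> (\<lambda>i. n - i) ` ?S. hom_coeff \<phi> (n - j) (Poly_Mapping.lookup v j))"
    by (rule sum.mono_neutral_left) (auto simp: finite_hom_coeff[OF h] in_keys_iff 0)
  also have "\<dots> = (\<Sum>j\<in>(\<lambda>i. n - i) ` ?S. hom_coeff \<phi> (n - j) (Poly_Mapping.lookup v j))"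
  proof (rule sum.mono_neutral_right)
    have "j \<in> (\<lambda>i. n - i) ` ?S" if "n - j \<in> ?S" for j
      using that by (rule rev_image_eqI) simp
    then have "hom_coeff \<phi> (n - j) = (\<lambda>_. 0)" if "j \<notin> (\<lambda>i. n - i) ` ?S" for j
      using that by blast
    then show "\<forall>j\<in>Poly_Mapping.keys v \<union> (\<lambda>i. n - i) ` ?S - (\<lambda>i. n - i) ` ?S. hom_coeff \<phi> (n - j) (Poly_Mapping.lookup v j) = 0"
      by (metis DiffE)
  qed (auto simp: finite_hom_coeff[OF h])
  also have "\<dots> = (\<Sum>i\<in>?S. hom_coeff \<phi> i (Poly_Mapping.lookup v (n - i)))"
    by (subst sum.reindex) (auto simp: inj_on_def)
  finally show "Poly_Mapping.lookup (\<phi> v) n = Poly_Mapping.lookup (Sum_any (\<lambda>i. lscale scale (Poly_Mapping.single i 1) (Poly_Mapping.map (hom_coeff \<phi> i) v))) n"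
    by (simp add: lookup_expansion[OF 0 finite_hom_coeff[OF h]])
qed

end

lemma lookup_btilde:
  assumes "symmetric_bilinear scale b"
  shows "Poly_Mapping.lookup (btilde b v w) n = (\<Sum>i\<in>Poly_Mapping.keys w. b (Poly_Mapping.lookup v (i - n)) (Poly_Mapping.lookup w i))"
proof -
  have 0: "b u 0 = 0" "b 0 u = 0" for u
    using assms unfolding symmetric_bilinear_def
    by (metis Vector_Spaces.linear.axioms(3) module_hom.zero)+
  have inner: "Sum_any (\<lambda>i. b (Poly_Mapping.lookup v (i - n)) (Poly_Mapping.lookup w i))
      = (\<Sum>i\<in>Poly_Mapping.keys w. b (Poly_Mapping.lookup v (i - n)) (Poly_Mapping.lookup w i))" for n
    by (rule Sum_any.expand_superset) (auto simp: in_keys_iff 0)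
  define c where "c = (\<lambda>n. \<Sum>i\<in>Poly_Mapping.keys w. b (Poly_Mapping.lookup v (i - n)) (Poly_Mapping.lookup w i))"
  define N where "N = insert n ((\<lambda>(i, j). i - j) ` (Poly_Mapping.keys w \<times> Poly_Mapping.keys v))"
  have "finite N" "n \<in> N" by (simp_all add: N_def)
  have "c m = 0" if "m \<notin> N" for m
    unfolding c_def
  proof (rule sum.neutral, rule ballI)
    fix i assume i: "i \<in> Poly_Mapping.keys w"
    have "i - m \<notin> Poly_Mapping.keys v"
    proof
      assume "i - m \<in> Poly_Mapping.keys v"
      with i have "m \<in> N"
        unfolding N_def by (intro insertI2 image_eqI[where x = "(i, i - m)"]) simp_all
      with that show False by contradiction
    qed
    then show "b (Poly_Mapping.lookup v (i - m)) (Poly_Mapping.lookup w i) = 0"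
      by (simp add: in_keys_iff 0)
  qed
  then have "{m. Poly_Mapping.single m (c m) \<noteq> 0} \<subseteq> N"
    by (metis (mono_tags, lifting) mem_Collect_eq single_zero subsetI)
  with \<open>finite N\<close> have "Sum_any (\<lambda>m. Poly_Mapping.single m (c m)) = (\<Sum>m\<in>N. Poly_Mapping.single m (c m))"
    by (rule Sum_any.expand_superset)
  then have "btilde b v w = (\<Sum>m\<in>N. Poly_Mapping.single m (c m))"
    unfolding btilde_def inner c_def .
  then have "Poly_Mapping.lookup (btilde b v w) n = (\<Sum>m\<in>N. if m = n then c m else 0)"
    by (simp add: lookup_sum lookup_single when_def)
  then show ?thesis
    using \<open>finite N\<close> \<open>n \<in> N\<close> by (simp add: c_def)
qed

lemma group_PU_group:
  assumes "vector_space scale"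
  shows "group (PU_group scale b)"
proof (rule groupI)
  interpret vector_space scale by fact
  interpret m: module "lscale scale" by (rule module_lscale)
  show "x \<otimes>\<^bsub>PU_group scale b\<^esub> y \<in> carrier (PU_group scale b)"
    if "x \<in> carrier (PU_group scale b)" "y \<in> carrier (PU_group scale b)" for x y
    using that by (auto simp: PU_group_def PU_def bij_comp module_hom_compose)
  show "\<one>\<^bsub>PU_group scale b\<^esub> \<in> carrier (PU_group scale b)"
    using m.module_hom_id by (simp add: PU_group_def PU_def)
  show "\<exists>y\<in>carrier (PU_group scale b). y \<otimes>\<^bsub>PU_group scale b\<^esub> x = \<one>\<^bsub>PU_group scale b\<^esub>"
    if "x \<in> carrier (PU_group scale b)" for x
  proof
    have x: "module_hom (lscale scale) (lscale scale) x" "bij x"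
      "btilde b (x v) (x w) = btilde b v w" for v w
      using that by (auto simp: PU_group_def PU_def)
    interpret x: module_hom "lscale scale" "lscale scale" x by fact
    have xi: "x (inv_into UNIV x v) = v" for v using x(2) by (simp add: bij_is_surj surj_f_inv_f)
    have inj: "x v = x w \<Longrightarrow> v = w" for v w using x(2) by (meson bij_is_inj injD)
    have "module_hom (lscale scale) (lscale scale) (inv_into UNIV x)"
      by unfold_locales (auto intro: inj simp: xi x.add x.scale)
    moreover have "btilde b (inv_into UNIV x v) (inv_into UNIV x w) = btilde b v w" for v w
      using x(3)[of "inv_into UNIV x v" "inv_into UNIV x w"] by (simp add: xi)
    ultimately show "inv_into UNIV x \<in> carrier (PU_group scale b)"
      using x(2) by (simp add: PU_group_def PU_def bij_imp_bij_inv)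
    show "inv_into UNIV x \<otimes>\<^bsub>PU_group scale b\<^esub> x = \<one>\<^bsub>PU_group scale b\<^esub>"
      using x(2) by (simp add: PU_group_def bij_is_inj)
  qed
qed (auto simp: PU_group_def o_assoc)

lemma at_one_comp:
  assumes "vector_space scale" "module_hom (lscale scale) (lscale scale) \<phi>"
  shows "at_one (\<phi> \<circ> \<psi>) = at_one \<phi> \<circ> at_one \<psi>"
proof
  interpret vector_space scale by fact
  fix v
  have *: "at_one \<chi> v = Sum_any (Poly_Mapping.lookup (\<chi> (Poly_Mapping.single 0 v)))" for \<chi> :: "'b laurent \<Rightarrow> 'b laurent"
    by (simp add: at_one_def hom_coeff_def)
  have "at_one (\<phi> \<circ> \<psi>) v = at_one \<phi> (Sum_any (Poly_Mapping.lookup (\<psi> (Poly_Mapping.single 0 v))))"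
    unfolding *[of "\<phi> \<circ> \<psi>"] comp_apply by (rule Sum_any_lookup_hom[OF assms(2)])
  then show "at_one (\<phi> \<circ> \<psi>) v = (at_one \<phi> \<circ> at_one \<psi>) v"
    unfolding *[of \<psi>, symmetric] by simp
qed

lemma subgroup_PPU:
  assumes "vector_space scale"
  shows "subgroup (PPU scale b) (PU_group scale b)"
proof -
  interpret group "PU_group scale b" by (rule group_PU_group[OF assms])
  have mult: "x \<otimes>\<^bsub>PU_group scale b\<^esub> y = x \<circ> y" for x y
    by (simp add: PU_group_def)
  have one: "at_one id = (id :: 'b \<Rightarrow> 'b)"
    by (rule ext) (simp add: at_one_def hom_coeff_def lookup_single)
  have hom: "module_hom (lscale scale) (lscale scale) x" if "x \<in> PU scale b" for x
    using that by (simp add: PU_def)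
  have car: "carrier (PU_group scale b) = PU scale b" and o: "\<one>\<^bsub>PU_group scale b\<^esub> = id"
    by (simp_all add: PU_group_def)
  show ?thesis
  proof (rule subgroupI)
    show "PPU scale b \<subseteq> carrier (PU_group scale b)" by (auto simp: PPU_def car)
    show "PPU scale b \<noteq> {}" using one one_closed by (auto simp: PPU_def car o)
    fix x assume x: "x \<in> PPU scale b"
    let ?y = "inv\<^bsub>PU_group scale b\<^esub> x"
    have y: "?y \<in> PU scale b" using x inv_closed[of x] by (simp add: PPU_def car)
    have "?y \<circ> x = id" using x l_inv[of x] by (simp add: PPU_def car o mult)
    then have "at_one ?y \<circ> at_one x = id"
      using at_one_comp[OF assms hom[OF y], of x] one by simp
    then show "?y \<in> PPU scale b" using x y by (simp add: PPU_def)
    fix z assume "z \<in> PPU scale b"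
    then show "x \<otimes>\<^bsub>PU_group scale b\<^esub> z \<in> PPU scale b"
      using x m_closed[of x z] by (simp add: PPU_def mult car at_one_comp[OF assms hom])
  qed
qed

lemma group_PPU_group: "vector_space scale \<Longrightarrow> group (PPU_group scale b)"
  unfolding PPU_group_def using subgroup.subgroup_is_group group_PU_group subgroup_PPU by blast

lemma submonoid_PPU_pos:
  assumes "vector_space scale"
  shows "submonoid (PPU_pos scale b) (PPU_group scale b)"
proof
  interpret vector_space scale by fact
  interpret G: group "PPU_group scale b" by (rule group_PPU_group[OF assms])
  have car: "carrier (PPU_group scale b) = PPU scale b" and o: "\<one>\<^bsub>PPU_group scale b\<^esub> = id"
    and mult: "\<And>x y. x \<otimes>\<^bsub>PPU_group scale b\<^esub> y = x \<circ> y"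
    by (simp_all add: PPU_group_def PU_group_def)
  show "PPU_pos scale b \<subseteq> carrier (PPU_group scale b)"
    by (auto simp: PPU_pos_def car)
  show "\<one>\<^bsub>PPU_group scale b\<^esub> \<in> PPU_pos scale b"
    using G.one_closed by (auto simp: PPU_pos_def car o hom_coeff_def lookup_single)
  fix \<phi> \<psi> assume *: "\<phi> \<in> PPU_pos scale b" "\<psi> \<in> PPU_pos scale b"
  then have h: "module_hom (lscale scale) (lscale scale) \<phi>"
    by (simp add: PPU_pos_def PPU_def PU_def)
  note 0 = module_hom.zero[OF Vector_Spaces.linear.axioms(3)[OF linear_hom_coeff[OF h]]]
  have "hom_coeff (\<phi> \<circ> \<psi>) n v = 0" if "n < 0" for n v
  proof -
    let ?u = "\<psi> (Poly_Mapping.single 0 v)"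
    have "hom_coeff (\<phi> \<circ> \<psi>) n v
        = (\<Sum>j\<in>Poly_Mapping.keys ?u. hom_coeff \<phi> (n - j) (hom_coeff \<psi> j v))"
      by (simp add: hom_coeff_def[of "\<phi> \<circ> \<psi>"] hom_coeff_def[of \<psi>] lookup_hom[OF h])
    also have "\<dots> = 0"
    proof (rule sum.neutral, safe)
      fix j
      show "hom_coeff \<phi> (n - j) (hom_coeff \<psi> j v) = 0"
      proof (cases "j < 0")
        case True
        then show ?thesis using *(2) by (simp add: PPU_pos_def 0)
      next
        case False
        then show ?thesis using *(1) that by (simp add: PPU_pos_def)
      qed
    qed
    finally show ?thesis .
  qed
  then show "\<phi> \<otimes>\<^bsub>PPU_group scale b\<^esub> \<psi> \<in> PPU_pos scale b"
    using * G.m_closed[of \<phi> \<psi>] by (auto simp: PPU_pos_def car mult)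
qed

end

theory Submission
  imports Defs
begin

text \<open>
  To \<open>\<phi>\<close> associate the \<open>k[t]\<close>-submodule \<open>\<Lambda>(\<phi>) = \<phi>\<inverse>(V[t])\<close> of \<open>V[t,t\<inverse>]\<close>. Then \<open>\<phi> \<le> \<psi>\<close> means
  \<open>\<Lambda>(\<phi>) \<subseteq> \<Lambda>(\<psi>)\<close>, so it suffices that \<open>\<Lambda>\<close> is a bijection onto the \<open>k[t]\<close>-submodules lying between some
  \<open>t\<^sup>mV[t]\<close> and \<open>t\<^sup>lV[t]\<close>, a family closed under intersections and sums.
  Since \<open>b\<close> is anisotropic, so is \<open>btilde b\<close>. For such a submodule \<open>\<Lambda>\<close> put \<open>U = \<Lambda> \<inter> (t\<Lambda>)\<^sup>\<bottom>\<close>, the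
  complement being taken for the \<open>t\<^sup>0\<close>-coefficient of \<open>btilde b\<close>. Anisotropy makes this
  form nondegenerate on \<open>t\<Lambda>\<close>, so \<open>\<Lambda> = U \<oplus> t\<Lambda>\<close>, and evaluation at \<open>t = 1\<close> is an isometry from
  \<open>U\<close> onto \<open>V\<close>; extending its inverse \<open>k[t,t\<inverse>]\<close>-linearly gives \<open>\<phi>\<inverse>\<close> for the unique \<open>\<phi>\<close>
  with \<open>\<Lambda>(\<phi>) = \<Lambda>\<close>.
\<close>

section \<open>Linear algebra: functionals represented by a bilinear form\<close>

context vector_space
begin

text \<open>This is the fact that a functional vanishing on the common kernel of finitely many
  others is a combination of them. The induction replaces \<open>F\<close> by the kernel of
  \<open>B s\<close> in \<open>F\<close>; a representative that is right there becomes right on all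
  of \<open>F\<close> after adding one multiple of \<open>s\<close>.\<close>

lemma functional_in_span:
  fixes B :: "'b \<Rightarrow> 'b \<Rightarrow> 'a"
  assumes add_left: "\<And>x y z. B (x + y) z = B x z + B y z"
    and scale_left: "\<And>a x z. B (scale a x) z = a * B x z"
    and add_right: "\<And>x y z. B x (y + z) = B x y + B x z"
    and scale_right: "\<And>a x z. B x (scale a z) = a * B x z"
    and "finite S" "subspace F"
    and "\<And>y. y \<in> F \<Longrightarrow> (\<forall>s\<in>S. B s y = 0) \<Longrightarrow> B x y = 0"
  shows "\<exists>a\<in>span S. \<forall>y\<in>F. B x y = B a y"
  using assms(5-)
proof (induction S arbitrary: F x rule: finite_induct)
  case empty
  have "B 0 y = 0" for y
    using scale_left[of 0 0] by simp
  then show ?case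
    using empty by (auto intro: span_zero)
next
  case (insert s S)
  have zero: "B y 0 = 0" for y
    using scale_right[of y 0 0] by simp
  let ?F = "{y \<in> F. B s y = 0}"
  have "subspace ?F"
    using insert.prems(1) unfolding subspace_def by (auto simp: add_right scale_right zero)
  moreover have "B x y = 0" if "y \<in> ?F" "\<forall>s\<in>S. B s y = 0" for y
    using insert.prems(2)[of y] that by auto
  ultimately obtain a where a: "a \<in> span S" "\<forall>y\<in>?F. B x y = B a y"
    using insert.IH[of ?F x] by blast
  have aS: "a \<in> span (insert s S)" "s \<in> span (insert s S)"
    using a(1) by (meson span_mono subset_insertI subsetD) (simp add: span_base)
  show ?case
  proof (cases "?F = F")
    case True
    then show ?thesis using a aS by auto
  next
    case False
    then obtain y0 where y0: "y0 \<in> F" "B s y0 \<noteq> 0" by auto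
    \<comment> \<open>The coefficient \<open>c\<close> makes \<open>a + scale c s\<close> agree with
      \<open>x\<close> at \<open>y0\<close>. Any other \<open>y\<close> in \<open>F\<close> is moved
      into \<open>?F\<close> by a multiple of \<open>y0\<close>.\<close>
    define c where "c = (B x y0 - B a y0) / B s y0"
    have "B x y = B (a + scale c s) y" if y: "y \<in> F" for y
    proof -
      define d where "d = - (B s y / B s y0)"
      let ?z = "y + scale d y0"
      have "B s y + d * B s y0 = 0"
        using y0(2) by (simp add: d_def)
      then have "?z \<in> ?F"
        using y y0(1) insert.prems(1) by (simp add: subspace_add subspace_scale add_right scale_right)
      then have "B x y + d * B x y0 = B a y + d * B a y0"
        using a(2) by (auto simp: add_right scale_right)
      then have "B x y = B a y - d * (B x y0 - B a y0)"
        by (simp add: algebra_simps)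
      also have "\<dots> = B a y + c * B s y"
        using y0 by (simp add: c_def d_def)
      finally show ?thesis
        by (simp add: add_left scale_left)
    qed
    then show ?thesis
      using aS by (intro bexI[of _ "a + scale c s"]) (auto intro: span_add span_scale)
  qed
qed

text \<open>Orthogonal projection onto \<open>F\<close>: the difference \<open>x - a\<close> is
  orthogonal to \<open>F\<close>. As \<open>F\<close> lies in \<open>span T\<close>, it has a finite
  basis \<open>S\<close>. By nondegeneracy only 0 in \<open>F\<close> is orthogonal to
  \<open>S\<close>, so \<open>functional_in_span\<close> applies to every \<open>x\<close>, inside
  \<open>F\<close> or not.\<close>

lemma nondegenerate_representation:
  fixes B :: "'b \<Rightarrow> 'b \<Rightarrow> 'a"
  assumes add_left: "\<And>x y z. B (x + y) z = B x z + B y z"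
    and scale_left: "\<And>a x z. B (scale a x) z = a * B x z"
    and sym: "\<And>x y. B x y = B y x"
    and T: "finite T" "F \<subseteq> span T" and F: "subspace F"
    and nondeg: "\<And>y. y \<in> F \<Longrightarrow> (\<forall>z\<in>F. B z y = 0) \<Longrightarrow> y = 0"
  shows "\<exists>a\<in>F. \<forall>y\<in>F. B x y = B a y"
proof -
  have add_right: "\<And>x y z. B x (y + z) = B x y + B x z"
    and scale_right: "\<And>a x z. B x (scale a z) = a * B x z"
    using add_left scale_left sym by metis+
  have zero: "B 0 y = 0" "B y 0 = 0" for y
    using scale_left[of 0 0] scale_right[of _ 0 0] by simp_all
  obtain S where S: "S \<subseteq> F" "independent S" "F \<subseteq> span S"
    using maximal_independent_subset by blast
  have "S \<subseteq> span T"
    using S(1) T(2) by blast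
  then have "finite S"
    using independent_span_bound[OF T(1) S(2)] by blast
  have "B x y = 0" if y: "y \<in> F" "\<forall>s\<in>S. B s y = 0" for y
  proof -
    have "B z y = 0" if "z \<in> F" for z
    proof -
      have "z \<in> span S" using that S(3) by blast
      then show ?thesis
        by (induction rule: span_induct_alt) (use y(2) in \<open>auto simp: add_left scale_left zero\<close>)
    qed
    then have "y = 0" using nondeg y(1) by blast
    then show ?thesis by (simp add: zero)
  qed
  then obtain a where "a \<in> span S" "\<forall>y\<in>F. B x y = B a y"
    using functional_in_span[OF add_left scale_left add_right scale_right \<open>finite S\<close> F] by blast
  moreover have "span S \<subseteq> F"
    by (rule span_minimal[OF S(1) F])
  ultimately show ?thesis by blast
qed

end

section \<open>Laurent vectors: membership in \<open>t^m V[t]\<close> and evaluation at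
  \<open>t = 1\<close>\<close>

definition vanishes_below :: "int \<Rightarrow> 'v::zero laurent \<Rightarrow> bool" where
  "vanishes_below m w \<longleftrightarrow> (\<forall>i<m. Poly_Mapping.lookup w i = 0)"

definition eval_one :: "'v::comm_monoid_add laurent \<Rightarrow> 'v" where
  "eval_one w = Sum_any (Poly_Mapping.lookup w)"

text \<open>A \<open>k\<close>-valued form, so that linear algebra over \<open>k\<close> applies;
  the other coefficients of \<open>btilde\<close> are recovered by multiplying an argument by powers
  of \<open>t\<close>.\<close>

definition const_form :: "('v::ab_group_add \<Rightarrow> 'v \<Rightarrow> 'k::field) \<Rightarrow> 'v laurent \<Rightarrow> 'v laurent \<Rightarrow> 'k" where
  "const_form b v w = Poly_Mapping.lookup (btilde b v w) 0"

lemma vanishes_below_mono: "vanishes_below m w \<Longrightarrow> l \<le> m \<Longrightarrow> vanishes_below l w"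
  by (simp add: vanishes_below_def)

lemma vanishes_below_exists: "\<exists>m. vanishes_below m w"
proof (cases "w = 0")
  case False
  then have "vanishes_below (Min (Poly_Mapping.keys w)) w"
    unfolding vanishes_below_def
    by (metis Min_le finite_keys in_keys_iff linorder_not_le)
  then show ?thesis ..
qed (simp add: vanishes_below_def)

lemma vanishes_above_exists: "\<exists>m. \<forall>i\<ge>m. Poly_Mapping.lookup w (i::int) = 0"
proof (cases "w = 0")
  case False
  then have "\<forall>i\<ge>Max (Poly_Mapping.keys w) + 1. Poly_Mapping.lookup w i = 0"
    by (metis Max_ge finite_keys in_keys_iff linorder_not_le zless_add1_eq order_less_le_trans less_add_one)
  then show ?thesis ..
qed simp

lemma eval_one_superset: "finite A \<Longrightarrow> Poly_Mapping.keys w \<subseteq> A \<Longrightarrow> eval_one w = (\<Sum>i\<in>A. Poly_Mapping.lookup w i)"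
  unfolding eval_one_def by (rule Sum_any.expand_superset) (auto simp: in_keys_iff)

lemma eval_one_add: "eval_one (v + w) = eval_one v + eval_one w"
  unfolding eval_one_def lookup_add by (rule Sum_any.distrib) simp_all

lemma eval_one_zero [simp]: "eval_one 0 = 0"
  by (simp add: eval_one_def)

lemma eval_one_single [simp]: "eval_one (Poly_Mapping.single i v) = v"
  by (simp add: eval_one_def lookup_single)

lemma finitely_supported_constant_eq_0:
  fixes f :: "int \<Rightarrow> 'a::zero"
  assumes step: "\<And>n. f (n + 1) = f n" and fin: "finite {n. f n \<noteq> 0}"
  shows "f n = 0"
proof -
  have const: "f m = f 0" for m
  proof (induction m rule: int_induct[of _ 0])
    case (step2 i)
    then show ?case using step[of "i - 1"] by simp
  qed (simp_all add: step)
  have "f 0 = 0"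
  proof (rule ccontr)
    assume "f 0 \<noteq> 0"
    then have "f m \<noteq> 0" for m using const[of m] by simp
    then have "{n. f n \<noteq> 0} = UNIV" by auto
    with fin show False by (simp add: infinite_UNIV_int)
  qed
  then show ?thesis using const[of n] by simp
qed

section \<open>The space \<open>V[t,t^-1]\<close> over \<open>k\<close> with multiplication by
  powers of \<open>t\<close>\<close>

locale anisotropic_space = finite_dimensional_vector_space scale Basis
  for scale :: "'k::field \<Rightarrow> 'v::ab_group_add \<Rightarrow> 'v" and Basis +
  fixes b :: "'v \<Rightarrow> 'v \<Rightarrow> 'k"
  assumes symmetric_bilinear: "symmetric_bilinear scale b"
    and anisotropic: "anisotropic b"
begin

abbreviation shift :: "int \<Rightarrow> 'v laurent \<Rightarrow> 'v laurent" where
  "shift n \<equiv> lscale scale (Poly_Mapping.single n 1)"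

abbreviation cscale :: "'k \<Rightarrow> 'v laurent \<Rightarrow> 'v laurent" where
  "cscale a \<equiv> lscale scale (Poly_Mapping.single 0 a)"

abbreviation \<beta> :: "'v laurent \<Rightarrow> 'v laurent \<Rightarrow> 'k" where
  "\<beta> \<equiv> const_form b"

text \<open>Restricting scalars to constants gives access to spans, subspaces and
  \<open>nondegenerate_representation\<close> for \<open>\<beta>\<close>.\<close>

sublocale laurent: vector_space cscale
proof -
  interpret m: module "lscale scale" by (rule module_lscale)
  show "vector_space cscale"
    by unfold_locales
      (simp_all add: lscale_add_right m.scale_left_distrib[symmetric] single_add lscale_lscale mult_single)
qed

lemma lookup_shift [simp]: "Poly_Mapping.lookup (shift n w) i = Poly_Mapping.lookup w (i - n)"
  by (simp add: lookup_lscale_single)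

lemma lookup_cscale [simp]: "Poly_Mapping.lookup (cscale a w) i = scale a (Poly_Mapping.lookup w i)"
  by (simp add: lookup_lscale_single)

lemma shift_add: "shift n (v + w) = shift n v + shift n w"
  by (rule lscale_add_right)

lemma shift_diff: "shift n (v - w) = shift n v - shift n w"
  by (rule poly_mapping_eqI) (simp add: lookup_minus)

lemma shift_cscale: "shift n (cscale a w) = cscale a (shift n w)"
  by (rule poly_mapping_eqI) simp

text \<open>This is \<open>shift 0 w = w\<close> with \<open>Poly_Mapping.single 0 1\<close> written
  as the ring unit \<open>1\<close>.\<close>

lemma shift_zero [simp]: "lscale scale 1 w = w"
  using module.scale_one[OF module_lscale] .

lemma shift_shift [simp]: "shift m (shift n w) = shift (m + n) w"
  by (rule poly_mapping_eqI) (simp add: algebra_simps)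

lemma lscale_single_eq: "lscale scale (Poly_Mapping.single i a) w = shift i (cscale a w)"
  by (rule poly_mapping_eqI) (simp add: lookup_lscale_single)

lemma shift_single [simp]: "shift m (Poly_Mapping.single n x) = Poly_Mapping.single (m + n) x"
  by (simp add: lscale_single_single)

lemma vanishes_below_shift [simp]: "vanishes_below m (shift n w) \<longleftrightarrow> vanishes_below (m - n) w"
  unfolding vanishes_below_def lookup_shift
proof safe
  fix i assume *: "\<forall>i<m. Poly_Mapping.lookup w (i - n) = 0" "i < m - n"
  then show "Poly_Mapping.lookup w i = 0" using *(1)[rule_format, of "i + n"] by simp
qed simp

lemma eval_one_shift [simp]: "eval_one (shift n w) = eval_one w"
  by (induction w rule: laurent_induct)
    (simp_all add: lscale_zero_right shift_add eval_one_add)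

lemma eval_one_cscale: "eval_one (cscale a w) = scale a (eval_one w)"
  by (induction w rule: laurent_induct)
    (simp_all add: lscale_zero_right lscale_single_single lscale_add_right eval_one_add scale_right_distrib)

lemma b_add_left: "b (x + y) z = b x z + b y z"
  and b_add_right: "b x (y + z) = b x y + b x z"
  and b_scale_left: "b (scale a x) z = a * b x z"
  and b_sym: "b x y = b y x"
  and b_zero [simp]: "b 0 x = 0" "b x 0 = 0"
proof -
  have l: "module_hom scale (*) (\<lambda>w. b v w)" "module_hom scale (*) (\<lambda>v. b v w)" for v w
    using symmetric_bilinear by (auto simp: symmetric_bilinear_def Vector_Spaces.linear_def)
  show "b (x + y) z = b x z + b y z" "b x (y + z) = b x y + b x z"
    "b (scale a x) z = a * b x z" "b 0 x = 0" "b x 0 = 0"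
    using module_hom.add[OF l(1)] module_hom.add[OF l(2)] module_hom.scale[OF l(2)]
      module_hom.zero[OF l(1)] module_hom.zero[OF l(2)] by auto
  show "b x y = b y x"
    using symmetric_bilinear by (auto simp: symmetric_bilinear_def)
qed

lemma b_eq_0_iff: "b x x = 0 \<longleftrightarrow> x = 0"
  using anisotropic by (auto simp: anisotropic_def)

section \<open>The form \<open>\<beta>\<close> and the anisotropy of \<open>btilde\<close>\<close>

lemma const_form_superset:
  assumes "finite A" "Poly_Mapping.keys v \<inter> Poly_Mapping.keys w \<subseteq> A"
  shows "\<beta> v w = (\<Sum>i\<in>A. b (Poly_Mapping.lookup v i) (Poly_Mapping.lookup w i))"
proof -
  have "\<beta> v w = (\<Sum>i\<in>Poly_Mapping.keys w. b (Poly_Mapping.lookup v i) (Poly_Mapping.lookup w i))"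
    by (simp add: const_form_def lookup_btilde[OF symmetric_bilinear])
  also have "\<dots> = (\<Sum>i\<in>Poly_Mapping.keys w \<union> A. b (Poly_Mapping.lookup v i) (Poly_Mapping.lookup w i))"
    by (rule sum.mono_neutral_left) (auto simp: assms in_keys_iff)
  also have "\<dots> = (\<Sum>i\<in>A. b (Poly_Mapping.lookup v i) (Poly_Mapping.lookup w i))"
    using assms by (intro sum.mono_neutral_right) (auto simp: in_keys_iff subset_iff, metis b_zero(1))
  finally show ?thesis .
qed

lemma const_form_keys: "\<beta> v w = (\<Sum>i\<in>Poly_Mapping.keys w. b (Poly_Mapping.lookup v i) (Poly_Mapping.lookup w i))"
  by (rule const_form_superset) auto

lemma const_form_add_left: "\<beta> (u + v) w = \<beta> u w + \<beta> v w"
  by (simp add: const_form_keys lookup_add b_add_left sum.distrib)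

lemma const_form_cscale_left: "\<beta> (cscale a v) w = a * \<beta> v w"
  by (simp add: const_form_keys b_scale_left sum_distrib_left)

lemma const_form_sym: "\<beta> v w = \<beta> w v"
proof -
  have "\<beta> v w = (\<Sum>i\<in>Poly_Mapping.keys v. b (Poly_Mapping.lookup v i) (Poly_Mapping.lookup w i))"
    by (rule const_form_superset) auto
  then show ?thesis
    by (simp add: const_form_keys b_sym)
qed

lemma const_form_add_right: "\<beta> w (u + v) = \<beta> w u + \<beta> w v"
  by (metis const_form_sym const_form_add_left)

lemma const_form_zero [simp]: "\<beta> 0 w = 0" "\<beta> w 0 = 0"
  by (simp_all add: const_form_keys)

lemma const_form_diff_left: "\<beta> (u - v) w = \<beta> u w - \<beta> v w"
  using const_form_add_left[of "u - v" v w] by (simp add: algebra_simps)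

lemma const_form_diff_right: "\<beta> w (u - v) = \<beta> w u - \<beta> w v"
  by (metis const_form_sym const_form_diff_left)

lemma const_form_single_right [simp]: "\<beta> v (Poly_Mapping.single i x) = b (Poly_Mapping.lookup v i) x"
  by (subst const_form_superset[of "{i}"]) auto

lemma const_form_shift: "\<beta> (shift n v) w = \<beta> v (shift (- n) w)"
  by (induction w rule: laurent_induct)
    (simp_all add: lscale_zero_right shift_add const_form_add_right)

lemma const_form_shift_shift: "\<beta> (shift i v) (shift j w) = \<beta> (shift (i - j) v) w"
  using const_form_shift[of "-j" "shift i v" w] by simp

text \<open>Reduces statements about \<open>btilde\<close> to \<open>\<beta>\<close> and shifts:
  \<open>btilde b v w\<close> is zero exactly when \<open>\<beta> (shift n v) w\<close> vanishes for
  all \<open>n\<close>.\<close>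

lemma lookup_btilde_eq: "Poly_Mapping.lookup (btilde b v w) n = \<beta> (shift n v) w"
  by (simp add: lookup_btilde[OF symmetric_bilinear] const_form_keys)

text \<open>The summands are the coefficients of \<open>btilde b v w\<close>, so the sum is its
  value at \<open>t = 1\<close>. By additivity in both arguments it suffices to compare monomials,
  where a single \<open>n\<close> contributes.\<close>

lemma sum_const_form_shift:
  "finite {n. \<beta> (shift n v) w \<noteq> 0} \<and> Sum_any (\<lambda>n. \<beta> (shift n v) w) = b (eval_one v) (eval_one w)"
proof -
  have "finite {n. \<beta> (shift n v) w \<noteq> 0}"
    using finite_lookup[of "btilde b v w"] unfolding lookup_btilde_eq .
  moreover have "Sum_any (\<lambda>n. \<beta> (shift n v) w) = b (eval_one v) (eval_one w)"
  proof (induction w rule: laurent_induct)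
    case (single j y)
    show ?case
    proof (induction v rule: laurent_induct)
      case (single i x)
      have "Sum_any (\<lambda>n. b (Poly_Mapping.lookup (Poly_Mapping.single i x) (j - n)) y)
        = (\<Sum>n\<in>{j - i}. b (Poly_Mapping.lookup (Poly_Mapping.single i x) (j - n)) y)"
        by (rule Sum_any.expand_superset) (auto simp: lookup_single when_def split: if_splits)
      then show ?case by (simp del: shift_single)
    next
      case (add p q)
      have fin: "finite {n. b (Poly_Mapping.lookup p (j - n)) y \<noteq> 0}" for p
        using finite_lookup[of "btilde b p (Poly_Mapping.single j y)"] unfolding lookup_btilde_eq by simp
      show ?case using add
        by (simp add: lookup_add b_add_left eval_one_add Sum_any.distrib[OF fin fin])
    qed simp
  next
    case (add p q)
    have fin: "finite {n. \<beta> (shift n v) q \<noteq> 0}" for q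
      using finite_lookup[of "btilde b v q"] unfolding lookup_btilde_eq .
    show ?case using add
      by (simp add: const_form_add_right b_add_right eval_one_add Sum_any.distrib[OF fin fin])
  qed simp
  ultimately show ?thesis ..
qed

text \<open>Division by \<open>1 - t\<close>: the coefficients of \<open>v\<close> are the partial
  sums \<open>P n\<close> of those of \<open>w\<close>. Before \<open>a\<close> these are empty;
  from \<open>a + int d\<close> on they comprise all of \<open>w\<close> and equal
  \<open>eval_one w = 0\<close>, which shortens the support by one degree.\<close>

lemma eval_one_eq_0_imp_divisible:
  assumes ev: "eval_one w = 0"
    and supp: "\<And>i. Poly_Mapping.lookup w i \<noteq> 0 \<Longrightarrow> i \<in> {a..<a + int (Suc d)}"
  shows "\<exists>v. w = v - shift 1 v \<and> (\<forall>i. Poly_Mapping.lookup v i \<noteq> 0 \<longrightarrow> i \<in> {a..<a + int d})"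
proof -
  define P where "P n = (\<Sum>j\<in>{a..n}. Poly_Mapping.lookup w j)" for n
  define v where "v = (\<Sum>i\<in>{a..<a + int d}. Poly_Mapping.single i (P i))"
  have v: "Poly_Mapping.lookup v n = (if n \<in> {a..<a + int d} then P n else 0)" for n
    by (simp add: v_def lookup_sum lookup_single when_def)
  have P: "P n = 0" if "n \<notin> {a..<a + int d}" for n
  proof (cases "n < a")
    case False
    with that have "eval_one w = P n"
      unfolding P_def by (intro eval_one_superset) (use supp in \<open>fastforce simp: in_keys_iff\<close>)+
    then show ?thesis using ev by simp
  qed (simp add: P_def)
  have step: "Poly_Mapping.lookup w n = P n - P (n - 1)" for n
  proof (cases "n < a")
    case True
    then show ?thesis using supp[of n] by (auto simp: P_def)
  next
    case False
    then have "{a..n} = insert n {a..n - 1}" by auto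
    then show ?thesis by (simp add: P_def)
  qed
  have "w = v - shift 1 v"
    by (rule poly_mapping_eqI) (auto simp: lookup_minus v P step)
  moreover have "\<forall>i. Poly_Mapping.lookup v i \<noteq> 0 \<longrightarrow> i \<in> {a..<a + int d}"
    by (simp add: v)
  ultimately show ?thesis by blast
qed

text \<open>An isotropic vector vanishes at \<open>t = 1\<close>, hence is divisible by \<open>1 - t\<close> with an isotropic
  quotient of smaller support.\<close>

lemma btilde_anisotropic:
  assumes "\<And>n. \<beta> (shift n w) w = 0"
  shows "w = 0"
proof -
  have *: "w = 0"
    if "\<And>n. \<beta> (shift n w) w = 0" "\<And>i. Poly_Mapping.lookup w i \<noteq> 0 \<Longrightarrow> i \<in> {a..<a + int d}"
    for w a d
    using that
  proof (induction d arbitrary: w)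
    case 0
    then show ?case by (intro poly_mapping_eqI) auto
  next
    case (Suc d)
    have "b (eval_one w) (eval_one w) = 0"
      using sum_const_form_shift[of w w] Suc.prems(1) by simp
    then have "eval_one w = 0" by (simp add: b_eq_0_iff)
    then obtain v where v: "w = v - shift 1 v"
      "\<And>i. Poly_Mapping.lookup v i \<noteq> 0 \<Longrightarrow> i \<in> {a..<a + int d}"
      using eval_one_eq_0_imp_divisible[of w a d] Suc.prems(2) by blast
    define c where "c n = \<beta> (shift n v) v" for n
    have fin: "finite {n. c n \<noteq> 0}"
      unfolding c_def using sum_const_form_shift by blast
    have c1: "\<beta> (shift m v) (shift 1 v) = c (m - 1)" for m
      using const_form_shift[of "-1" "shift m v" v] by (simp add: c_def)
    \<comment> \<open>Since \<open>w = (1 - t) v\<close>, the sequence \<open>c\<close> is acted on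
      by \<open>(1 - t)(1 - t^-1)\<close>, that is, by minus the second difference. Finite support
      then forces first the differences of \<open>c\<close> and then \<open>c\<close> itself to
      vanish, so \<open>v\<close> is isotropic too.\<close>
    have "\<beta> (shift n w) w = (c n - c (n - 1)) - (c (n + 1) - c n)" for n
      unfolding v(1) by (simp add: shift_diff const_form_diff_left const_form_diff_right c1) (simp add: c_def)
    with Suc.prems(1) have second: "c (n + 1) - c n = c n - c (n - 1)" for n
      by (metis eq_iff_diff_eq_0)
    have "finite {n. c (n + 1) - c n \<noteq> 0}"
    proof (rule finite_subset)
      show "{n. c (n + 1) - c n \<noteq> 0} \<subseteq> {n. c n \<noteq> 0} \<union> (\<lambda>n. n - 1) ` {n. c n \<noteq> 0}"
      proof
        fix n assume n: "n \<in> {n. c (n + 1) - c n \<noteq> 0}"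
        then have "c n \<noteq> 0 \<or> n + 1 \<in> {n. c n \<noteq> 0}" by auto
        then show "n \<in> {n. c n \<noteq> 0} \<union> (\<lambda>n. n - 1) ` {n. c n \<noteq> 0}"
          using image_eqI[of n "\<lambda>n. n - 1" "n + 1"] by auto
      qed
    qed (use fin in simp)
    then have "c (n + 1) - c n = 0" for n
      by (intro finitely_supported_constant_eq_0[of "\<lambda>n. c (n + 1) - c n"])
        (use second[of "_ + 1"] in simp_all)
    then have "c n = 0" for n
      using fin by (intro finitely_supported_constant_eq_0) simp_all
    then have "v = 0"
      using Suc.IH[of v] v(2) by (simp add: c_def)
    then show ?case by (simp add: v(1) lscale_zero_right)
  qed
  obtain l where l: "vanishes_below l w" using vanishes_below_exists by blast
  obtain m where m: "\<forall>i\<ge>m. Poly_Mapping.lookup w i = 0" using vanishes_above_exists by blast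
  have "i \<in> {l..<l + int (nat (m - l))}" if "Poly_Mapping.lookup w i \<noteq> 0" for i
  proof -
    have "l \<le> i" "i < m"
      using l m that unfolding vanishes_below_def by (meson not_less)+
    then show ?thesis by simp
  qed
  with assms show ?thesis by (rule *)
qed

section \<open>Bounded \<open>k[t]\<close>-submodules and their wandering subspaces\<close>

text \<open>Being a \<open>k[t]\<close>-submodule is split into being a \<open>k\<close>-subspace
  and being stable under \<open>t\<close>, so that arguments over \<open>k\<close> apply
  directly.\<close>

definition bounded_submodule :: "'v laurent set \<Rightarrow> bool" where
  "bounded_submodule \<Lambda> \<longleftrightarrow> laurent.subspace \<Lambda> \<and> shift 1 ` \<Lambda> \<subseteq> \<Lambda> \<and>
    (\<exists>m. {w. vanishes_below m w} \<subseteq> \<Lambda>) \<and> (\<exists>l. \<Lambda> \<subseteq> {w. vanishes_below l w})"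

text \<open>The \<open>U\<close> of the overview, an analogue of the wandering subspace in the Wold
  decomposition for \<open>t\<close> acting on \<open>\<Lambda>\<close>.\<close>

definition wandering :: "'v laurent set \<Rightarrow> 'v laurent set" where
  "wandering \<Lambda> = {u \<in> \<Lambda>. \<forall>w\<in>\<Lambda>. \<beta> u (shift 1 w) = 0}"

lemma const_form_eq_0I:
  assumes "vanishes_below N w" "\<forall>i\<ge>N. Poly_Mapping.lookup v i = 0"
  shows "\<beta> v w = 0"
  unfolding const_form_keys by (rule sum.neutral) (use assms in \<open>metis b_zero vanishes_below_def not_less\<close>)

text \<open>Only finitely many degrees occur and \<open>V\<close> has a finite basis, so monomials
  over \<open>Basis\<close> span. This supplies the finite \<open>T\<close> for
  \<open>nondegenerate_representation\<close>.\<close>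

lemma bounded_interval_spanned:
  "\<exists>T. finite T \<and> {w. vanishes_below l w \<and> (\<forall>i\<ge>N. Poly_Mapping.lookup (w :: 'v laurent) i = 0)} \<subseteq> laurent.span T"
proof (intro exI conjI subsetI)
  let ?T = "(\<lambda>(i, x). Poly_Mapping.single i x) ` ({l..<N} \<times> Basis)"
  show "finite ?T" by (simp add: finite_Basis)
  have single: "Poly_Mapping.single i x \<in> laurent.span ?T" if i: "i \<in> {l..<N}" for i x
  proof -
    have "x \<in> span Basis" by (simp add: span_Basis)
    then show ?thesis
    proof (induction rule: span_induct_alt)
      case base
      then show ?case by (simp add: laurent.span_zero)
    next
      case (step c x y)
      have "Poly_Mapping.single i (scale c x + y) = cscale c (Poly_Mapping.single i x) + Poly_Mapping.single i y"
        by (simp add: lscale_single_single single_add)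
      moreover have "Poly_Mapping.single i x \<in> laurent.span ?T"
        using step i by (intro laurent.span_base) auto
      ultimately show ?case
        using step by (simp add: laurent.span_add laurent.span_scale del: lookup_cscale)
    qed
  qed
  fix w :: "'v laurent" assume "w \<in> {w. vanishes_below l w \<and> (\<forall>i\<ge>N. Poly_Mapping.lookup w i = 0)}"
  then have "w = (\<Sum>i\<in>{l..<N}. Poly_Mapping.single i (Poly_Mapping.lookup w i))"
    by (intro poly_mapping_eqI) (auto simp: lookup_sum lookup_single when_def vanishes_below_def not_less)
  then show "w \<in> laurent.span ?T"
    by (metis (no_types, lifting) single laurent.span_sum)
qed

context
  fixes \<Lambda>
  assumes \<Lambda>: "bounded_submodule \<Lambda>"
begin

lemma subspace_bounded_submodule: "laurent.subspace \<Lambda>"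
  using \<Lambda> by (simp add: bounded_submodule_def)

lemma shift_mem: "w \<in> \<Lambda> \<Longrightarrow> n \<ge> 0 \<Longrightarrow> shift n w \<in> \<Lambda>"
proof (induction "nat n" arbitrary: n)
  case (Suc k)
  then have "shift (n - 1) w \<in> \<Lambda>" by simp
  then have "shift 1 (shift (n - 1) w) \<in> \<Lambda>"
    using \<Lambda> unfolding bounded_submodule_def by blast
  then show ?case by simp
qed simp

text \<open>For \<open>n > 0\<close> a vector of \<open>U\<close> times \<open>t^n\<close> lies in
  t\<Lambda>, to which \<open>U\<close> is orthogonal; symmetry settles \<open>n < 0\<close>. Hence
  \<open>btilde b u u'\<close> is constant and equals its value at \<open>t = 1\<close>, so
  evaluation is an isometry on \<open>U\<close>.\<close>

lemma wandering_orthogonal: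
  assumes "u \<in> wandering \<Lambda>" "u' \<in> wandering \<Lambda>"
  shows "\<beta> (shift n u) u' = (if n = 0 then b (eval_one u) (eval_one u') else 0)"
proof -
  have pos: "\<beta> v (shift n w) = 0" if "n > 0" "v \<in> wandering \<Lambda>" "w \<in> wandering \<Lambda>" for n v w
  proof -
    have "shift (n - 1) w \<in> \<Lambda>" using that by (intro shift_mem) (auto simp: wandering_def)
    then have "\<beta> v (shift 1 (shift (n - 1) w)) = 0" using that by (auto simp: wandering_def)
    then show ?thesis by simp
  qed
  have 0: "\<beta> (shift n u) u' = 0" if "n \<noteq> 0" for n
  proof (cases "n > 0")
    case True
    then show ?thesis using pos[of n u' u] assms by (simp add: const_form_sym)
  next
    case False
    then show ?thesis using pos[of "-n" u u'] assms that by (simp add: const_form_shift)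
  qed
  have "Sum_any (\<lambda>n. \<beta> (shift n u) u') = (\<Sum>n\<in>{0}. \<beta> (shift n u) u')"
    by (rule Sum_any.expand_superset) (use 0 in auto)
  then have "\<beta> (shift 0 u) u' = b (eval_one u) (eval_one u')"
    using sum_const_form_shift[of u u'] by simp
  then show ?thesis using 0 by simp
qed

text \<open>By \<open>wandering_orthogonal\<close> every coefficient of \<open>btilde b u u\<close>
  is zero, so anisotropy of \<open>btilde\<close> applies.\<close>

lemma wandering_eval_one_inj:
  assumes "u \<in> wandering \<Lambda>" "eval_one u = 0"
  shows "u = 0"
  by (rule btilde_anisotropic) (simp add: wandering_orthogonal assms)

text \<open>The vector \<open>shift 1 v\<close> is the orthogonal projection of \<open>w\<close>
  onto t\<Lambda>. As that space need not be finite-dimensional, the projection is made onto its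
  part \<open>F\<close> in degrees below \<open>N\<close>, and \<open>orth\<close> shows that
  nothing is lost.\<close>

lemma wandering_decomposition:
  assumes w: "w \<in> \<Lambda>"
  shows "\<exists>u\<in>wandering \<Lambda>. \<exists>v\<in>\<Lambda>. w = u + shift 1 v"
proof -
  obtain m l where m: "{w. vanishes_below m w} \<subseteq> \<Lambda>" and l: "\<Lambda> \<subseteq> {w. vanishes_below l w}"
    using \<Lambda> by (auto simp: bounded_submodule_def)
  obtain N0 where N0: "\<forall>i\<ge>N0. Poly_Mapping.lookup w i = 0"
    using vanishes_above_exists by blast
  \<comment> \<open>The bound \<open>N0\<close> puts \<open>w\<close> in degrees below
    \<open>N\<close>; the bound \<open>m + 1\<close> puts \<open>t^N V[t]\<close> inside
    t\<Lambda>.\<close>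
  define N where "N = max N0 (m + 1)"
  let ?below = "\<lambda>w. \<forall>i\<ge>N. Poly_Mapping.lookup w i = 0"
  have wN: "?below w" using N0 by (simp add: N_def)
  define F where "F = {y \<in> shift 1 ` \<Lambda>. ?below y}"
  have mem: "y \<in> shift 1 ` \<Lambda> \<longleftrightarrow> shift (-1) y \<in> \<Lambda>" for y
    by (auto simp: image_iff intro!: bexI[of _ "shift (-1) y"])
  have F_iff: "y \<in> F \<longleftrightarrow> shift (-1) y \<in> \<Lambda> \<and> ?below y" for y
    by (auto simp: F_def mem)
  have sub: "laurent.subspace F"
    using subspace_bounded_submodule unfolding laurent.subspace_def Ball_def F_iff
    by (simp add: shift_add shift_cscale lookup_add lscale_zero_right)
  obtain T where T: "finite T" "{w. vanishes_below l w \<and> ?below w} \<subseteq> laurent.span T"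
    using bounded_interval_spanned by blast
  have "F \<subseteq> \<Lambda>"
    using \<Lambda> by (auto simp: F_def bounded_submodule_def)
  then have FT: "F \<subseteq> laurent.span T"
    using T(2) l by (auto simp: F_def)
  \<comment> \<open>The part \<open>h\<close> of \<open>shift 1 v\<close> in degrees from
    \<open>N\<close> on lies in t\<Lambda> and shares no degree with \<open>x\<close>. What remains
    of \<open>shift 1 v\<close> lies in \<open>F\<close>.\<close>
  have orth: "\<beta> x (shift 1 v) = 0" if x: "?below x" "\<forall>y\<in>F. \<beta> x y = 0" and v: "v \<in> \<Lambda>" for x v
  proof -
    let ?y = "shift 1 v"
    define K where "K = {i \<in> Poly_Mapping.keys ?y. i \<ge> N}"
    define h where "h = (\<Sum>i\<in>K. Poly_Mapping.single i (Poly_Mapping.lookup ?y i))"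
    have "finite K" by (simp add: K_def)
    then have "Poly_Mapping.lookup h i = (if i \<in> K then Poly_Mapping.lookup ?y i else 0)" for i
      by (simp add: h_def lookup_sum lookup_single when_def)
    then have h: "Poly_Mapping.lookup h i = (if i \<ge> N then Poly_Mapping.lookup ?y i else 0)" for i
      by (auto simp: K_def in_keys_iff)
    have hN: "vanishes_below N h" by (simp add: vanishes_below_def h)
    then have "shift (-1) h \<in> \<Lambda>"
      using m vanishes_below_mono[OF hN, of "m + 1"] by (auto simp: N_def)
    then have "shift (-1) (?y - h) \<in> \<Lambda>"
      using v laurent.subspace_diff[OF subspace_bounded_submodule] by (simp add: shift_diff)
    moreover have "?below (?y - h)"
      by (auto simp: lookup_minus h)
    ultimately have "?y - h \<in> F" by (simp add: F_iff)
    then have "\<beta> x (?y - h) = 0" using x(2) by blast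
    moreover have "\<beta> x h = 0"
      by (rule const_form_eq_0I[OF hN x(1)])
    ultimately show ?thesis
      by (simp add: const_form_diff_right)
  qed
  \<comment> \<open>By \<open>orth\<close>, such a \<open>y\<close> is orthogonal to all of
    t\<Lambda>, in particular to \<open>shift n y\<close> for \<open>n \<ge> 0\<close>. Moving the
    shift to the other argument covers negative \<open>n\<close>, so \<open>y\<close> is isotropic
    for \<open>btilde\<close>.\<close>
  have nondeg: "y = 0" if y: "y \<in> F" "\<forall>z\<in>F. \<beta> z y = 0" for y
  proof (rule btilde_anisotropic)
    have y': "\<forall>z\<in>F. \<beta> y z = 0" using y(2) const_form_sym by metis
    have pos: "\<beta> y (shift n y) = 0" if "n \<ge> 0" for n
    proof -
      have "\<beta> y (shift 1 (shift n (shift (-1) y))) = 0"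
      proof (rule orth)
        show "shift n (shift (-1) y) \<in> \<Lambda>"
          by (rule shift_mem) (use y(1) that in \<open>simp_all add: F_iff\<close>)
      qed (use y(1) y' in \<open>simp_all add: F_iff\<close>)
      then show ?thesis by simp
    qed
    show "\<beta> (shift n y) y = 0" for n
    proof (cases "n \<ge> 0")
      case True
      then show ?thesis using pos[of n] const_form_sym by metis
    next
      case False
      then show ?thesis using pos[of "-n"] by (simp add: const_form_shift)
    qed
  qed
  obtain a where a: "a \<in> F" "\<forall>y\<in>F. \<beta> w y = \<beta> a y"
    using laurent.nondegenerate_representation[where B = \<beta> and x = w,
      OF const_form_add_left const_form_cscale_left const_form_sym T(1) FT sub nondeg] by blast
  \<comment> \<open>Both \<open>w\<close> and \<open>a\<close> live in degrees below
    \<open>N\<close>, so \<open>orth\<close> extends orthogonality from \<open>F\<close> to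
    t\<Lambda>.\<close>
  have "w - a \<in> wandering \<Lambda>"
    unfolding wandering_def
  proof (intro CollectI conjI ballI)
    show "w - a \<in> \<Lambda>" using w a \<open>F \<subseteq> \<Lambda>\<close> laurent.subspace_diff[OF subspace_bounded_submodule] by blast
    show "\<beta> (w - a) (shift 1 v) = 0" if "v \<in> \<Lambda>" for v
      by (rule orth[OF _ _ that]) (use a wN in \<open>simp_all add: F_iff lookup_minus const_form_diff_left\<close>)
  qed
  moreover have "w = (w - a) + shift 1 (shift (-1) a)" by simp
  ultimately show ?thesis using a(1) unfolding F_iff by blast
qed

text \<open>An induction principle: \<open>\<Lambda>\<close> arises from \<open>U\<close> by sums
  and multiplication by \<open>t\<close>. Repeated use of \<open>wandering_decomposition\<close>
  stops because \<open>w\<close> is orthogonal to t^j\<Lambda> once \<open>j\<close> lifts \<Lambda>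
  above the degrees of \<open>w\<close>, and each step lowers \<open>j\<close> by one.\<close>

lemma wandering_generates:
  assumes w: "w \<in> \<Lambda>" and U: "wandering \<Lambda> \<subseteq> D"
    and add: "\<And>x y. x \<in> D \<Longrightarrow> y \<in> D \<Longrightarrow> x + y \<in> D" and shift: "\<And>x. x \<in> D \<Longrightarrow> shift 1 x \<in> D"
  shows "w \<in> D"
proof -
  have *: "w \<in> D" if "w \<in> \<Lambda>" "\<forall>v\<in>\<Lambda>. \<beta> w (shift (int j) v) = 0" for w j
    using that
  proof (induction j arbitrary: w)
    case 0
    then have perp: "\<forall>v\<in>\<Lambda>. \<beta> w v = 0" by simp
    \<comment> \<open>Orthogonality to \<open>\<Lambda>\<close> includes orthogonality to its subset
      t\<Lambda>.\<close>
    have "w \<in> wandering \<Lambda>"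
      unfolding wandering_def using 0(1) perp shift_mem by auto
    then show ?case using U by blast
  next
    case (Suc j)
    obtain u v where uv: "u \<in> wandering \<Lambda>" "v \<in> \<Lambda>" "w = u + shift 1 v"
      using wandering_decomposition[OF Suc.prems(1)] by blast
    have "\<beta> v (shift (int j) x) = 0" if x: "x \<in> \<Lambda>" for x
    proof -
      have "\<beta> u (shift 1 (shift (int j) x)) = 0"
        using uv(1) shift_mem[OF x, of "int j"] by (simp add: wandering_def del: shift_shift)
      moreover have "\<beta> w (shift (int (Suc j)) x) = 0"
        using Suc.prems(2) x by blast
      moreover have "\<beta> (shift 1 v) (shift (int (Suc j)) x) = \<beta> v (shift (int j) x)"
        by (simp add: const_form_shift)
      ultimately show ?thesis by (simp add: uv(3) const_form_add_left)
    qed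
    then have "v \<in> D" using Suc.IH uv(2) by blast
    then show ?case using uv U add shift by blast
  qed
  obtain l where l: "\<Lambda> \<subseteq> {w. vanishes_below l w}"
    using \<Lambda> by (auto simp: bounded_submodule_def)
  obtain N where N: "\<forall>i\<ge>N. Poly_Mapping.lookup w i = 0"
    using vanishes_above_exists by blast
  have "\<beta> w (shift (int (nat (N - l))) v) = 0" if "v \<in> \<Lambda>" for v
    by (rule const_form_eq_0I[OF _ N]) (use l that in \<open>auto elim!: vanishes_below_mono\<close>)
  then show ?thesis using * w by blast
qed

text \<open>The vectors whose value at \<open>t = 1\<close> is attained on \<open>U\<close> contain
  \<open>U\<close> and are closed under sums and under \<open>t\<close>, so they exhaust
  \<open>\<Lambda>\<close>. A monomial \<open>t^m x\<close> in \<open>\<Lambda>\<close> then shows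
  that \<open>x\<close> is attained.\<close>

lemma wandering_eval_one_surj: "\<exists>u\<in>wandering \<Lambda>. eval_one u = x"
proof -
  obtain m where m: "{w. vanishes_below m w} \<subseteq> \<Lambda>"
    using \<Lambda> by (auto simp: bounded_submodule_def)
  have "Poly_Mapping.single m x \<in> \<Lambda>"
    using m by (auto simp: vanishes_below_def lookup_single)
  then have "Poly_Mapping.single m x \<in> {w. eval_one w \<in> eval_one ` wandering \<Lambda>}"
  proof (rule wandering_generates)
    fix v w assume "v \<in> {w. eval_one w \<in> eval_one ` wandering \<Lambda>}" "w \<in> {w. eval_one w \<in> eval_one ` wandering \<Lambda>}"
    then obtain u u' where u: "u \<in> wandering \<Lambda>" "u' \<in> wandering \<Lambda>" "eval_one v = eval_one u" "eval_one w = eval_one u'"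
      by auto
    then have "u + u' \<in> wandering \<Lambda>"
      using laurent.subspace_add[OF subspace_bounded_submodule] by (auto simp: wandering_def const_form_add_left)
    then show "v + w \<in> {w. eval_one w \<in> eval_one ` wandering \<Lambda>}"
      using u by (auto simp: eval_one_add intro!: image_eqI[of _ _ "u + u'"])
  qed auto
  then show ?thesis by auto
qed

end

section \<open>Pure paraunitary maps and the submodules attached to them\<close>

abbreviation inverse_PPU :: "('v laurent \<Rightarrow> 'v laurent) \<Rightarrow> 'v laurent \<Rightarrow> 'v laurent" where
  "inverse_PPU \<equiv> m_inv (PPU_group scale b)"

lemma PPU_hom: "\<phi> \<in> PPU scale b \<Longrightarrow> module_hom (lscale scale) (lscale scale) \<phi>"
  and PPU_const_form: "\<phi> \<in> PPU scale b \<Longrightarrow> \<beta> (\<phi> v) (\<phi> w) = \<beta> v w"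
  by (simp_all add: PPU_def PU_def const_form_def)

lemma PPU_shift: "\<phi> \<in> PPU scale b \<Longrightarrow> \<phi> (shift n w) = shift n (\<phi> w)"
  by (rule module_hom.scale[OF PPU_hom])

lemma eval_one_PPU:
  assumes "\<phi> \<in> PPU scale b"
  shows "eval_one (\<phi> w) = eval_one w"
  using Sum_any_lookup_hom[OF PPU_hom[OF assms], of w] assms by (simp add: eval_one_def PPU_def)

lemma PPU_group_simps:
  "carrier (PPU_group scale b) = PPU scale b" "\<one>\<^bsub>PPU_group scale b\<^esub> = id"
  "x \<otimes>\<^bsub>PPU_group scale b\<^esub> y = x \<circ> y"
  by (simp_all add: PPU_group_def PU_group_def)

lemma PPU_comp: "\<phi> \<in> PPU scale b \<Longrightarrow> \<psi> \<in> PPU scale b \<Longrightarrow> \<phi> \<circ> \<psi> \<in> PPU scale b"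
  using monoid.m_closed[OF group.is_monoid[OF group_PPU_group[OF vector_space_axioms, where b = b]], of \<phi> \<psi>]
  by (simp add: PPU_group_simps)

lemma PPU_inverse:
  assumes "\<phi> \<in> PPU scale b"
  shows "inverse_PPU \<phi> \<in> PPU scale b"
    and "inverse_PPU \<phi> (\<phi> w) = w" and "\<phi> (inverse_PPU \<phi> w) = w"
proof -
  interpret G: group "PPU_group scale b" by (rule group_PPU_group[OF vector_space_axioms])
  show "inverse_PPU \<phi> \<in> PPU scale b"
    using G.inv_closed[of \<phi>] assms by (simp add: PPU_group_simps)
  show "inverse_PPU \<phi> (\<phi> w) = w" "\<phi> (inverse_PPU \<phi> w) = w"
    using G.l_inv[of \<phi>] G.r_inv[of \<phi>] assms by (simp_all add: PPU_group_simps fun_eq_iff)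
qed

lemma vanishes_below_hom:
  assumes h: "module_hom (lscale scale) (lscale scale) \<phi>"
    and "\<And>i. i < m \<Longrightarrow> hom_coeff \<phi> i = (\<lambda>_. 0)" and w: "vanishes_below l w"
  shows "vanishes_below (l + m) (\<phi> w)"
  unfolding vanishes_below_def lookup_hom[OF h]
proof (intro allI impI sum.neutral ballI)
  fix n j assume "n < l + m" "j \<in> Poly_Mapping.keys w"
  moreover have "l \<le> j"
    using calculation(2) w unfolding vanishes_below_def by (meson in_keys_iff not_less)
  ultimately show "hom_coeff \<phi> (n - j) (Poly_Mapping.lookup w j) = 0"
    using assms(2)[of "n - j"] by simp
qed

text \<open>Finite dimension leaves only finitely many nonzero \<open>hom_coeff \<phi> i\<close>, so
  one \<open>m\<close> bounds the loss of degree for all vectors.\<close>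

lemma PPU_vanishes_below:
  assumes "\<phi> \<in> PPU scale b"
  shows "\<exists>m. \<forall>l w. vanishes_below l w \<longrightarrow> vanishes_below (l + m) (\<phi> w)"
proof -
  have "bdd_below {i. hom_coeff \<phi> i \<noteq> (\<lambda>_. 0)}"
    using finite_hom_coeff[OF PPU_hom[OF assms]] by (rule bdd_below_finite)
  then obtain m where "\<And>i. hom_coeff \<phi> i \<noteq> (\<lambda>_. 0) \<Longrightarrow> m \<le> i"
    by (auto simp: bdd_below_def)
  then have "hom_coeff \<phi> i = (\<lambda>_. 0)" if "i < m" for i
    using that by (meson not_less)
  then show ?thesis
    using vanishes_below_hom[OF PPU_hom[OF assms]] by blast
qed

text \<open>The \<open>\<Lambda>(\<phi>)\<close> of the overview, written as a preimage to avoid the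
  group inverse.\<close>

definition integral_vectors :: "('v laurent \<Rightarrow> 'v laurent) \<Rightarrow> 'v laurent set" where
  "integral_vectors \<phi> = {w. vanishes_below 0 (\<phi> w)}"

text \<open>The degree bound for \<open>\<phi>\<close> gives the inner bound, the one for its
  inverse gives the outer bound.\<close>

lemma bounded_submodule_integral_vectors:
  assumes \<phi>: "\<phi> \<in> PPU scale b"
  shows "bounded_submodule (integral_vectors \<phi>)"
  unfolding bounded_submodule_def
proof (intro conjI)
  interpret \<phi>: module_hom "lscale scale" "lscale scale" \<phi> by (rule PPU_hom[OF \<phi>])
  show "laurent.subspace (integral_vectors \<phi>)"
    by (simp add: laurent.subspace_def integral_vectors_def vanishes_below_def \<phi>.zero \<phi>.add \<phi>.scale lookup_add)
  show "shift 1 ` integral_vectors \<phi> \<subseteq> integral_vectors \<phi>"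
    by (auto simp: integral_vectors_def \<phi>.scale vanishes_below_def)
  obtain m where "\<forall>l w. vanishes_below l w \<longrightarrow> vanishes_below (l + m) (\<phi> w)"
    using PPU_vanishes_below[OF \<phi>] by blast
  then show "\<exists>m. {w. vanishes_below m w} \<subseteq> integral_vectors \<phi>"
    by (intro exI[of _ "-m"]) (force simp: integral_vectors_def)
  let ?\<psi> = "inverse_PPU \<phi>"
  obtain m where m: "\<forall>l w. vanishes_below l w \<longrightarrow> vanishes_below (l + m) (?\<psi> w)"
    using PPU_vanishes_below[OF PPU_inverse(1)[OF \<phi>]] by blast
  have "vanishes_below m w" if "vanishes_below 0 (\<phi> w)" for w
    using m[rule_format, OF that] by (simp add: PPU_inverse(2)[OF \<phi>])
  then show "\<exists>l. integral_vectors \<phi> \<subseteq> {w. vanishes_below l w}"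
    by (auto simp: integral_vectors_def)
qed

text \<open>Positivity of \<open>?\<theta>\<close> means that it maps \<open>V[t]\<close> into
  itself; testing on constants suffices because they determine \<open>hom_coeff\<close>.
  Substituting \<open>\<phi> w\<close> for the argument turns this into the inclusion.\<close>

lemma le_PPU_order_iff:
  assumes \<phi>: "\<phi> \<in> PPU scale b" and \<psi>: "\<psi> \<in> PPU scale b"
  shows "\<phi> \<sqsubseteq>\<^bsub>PPU_order scale b\<^esub> \<psi> \<longleftrightarrow> integral_vectors \<phi> \<subseteq> integral_vectors \<psi>"
proof -
  let ?\<theta> = "\<psi> \<circ> inverse_PPU \<phi>"
  have \<theta>: "?\<theta> \<in> PPU scale b"
    by (intro PPU_comp \<psi> PPU_inverse(1)[OF \<phi>])
  have "\<phi> \<sqsubseteq>\<^bsub>PPU_order scale b\<^esub> \<psi> \<longleftrightarrow> (\<forall>i<0. hom_coeff ?\<theta> i = (\<lambda>_. 0))"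
    using \<theta> by (simp add: PPU_order_def PPU_group_simps PPU_pos_def)
  also have "\<dots> \<longleftrightarrow> (\<forall>w. vanishes_below 0 w \<longrightarrow> vanishes_below 0 (?\<theta> w))"
  proof
    assume "\<forall>i<0. hom_coeff ?\<theta> i = (\<lambda>_. 0)"
    then show "\<forall>w. vanishes_below 0 w \<longrightarrow> vanishes_below 0 (?\<theta> w)"
      using vanishes_below_hom[OF PPU_hom[OF \<theta>], of 0 0] by simp
  next
    assume *: "\<forall>w. vanishes_below 0 w \<longrightarrow> vanishes_below 0 (?\<theta> w)"
    have "vanishes_below 0 (?\<theta> (Poly_Mapping.single 0 v))" for v
      by (rule *[rule_format]) (simp add: vanishes_below_def lookup_single)
    then show "\<forall>i<0. hom_coeff ?\<theta> i = (\<lambda>_. 0)"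
      by (simp add: hom_coeff_def vanishes_below_def fun_eq_iff)
  qed
  also have "\<dots> \<longleftrightarrow> integral_vectors \<phi> \<subseteq> integral_vectors \<psi>"
  proof
    assume *: "\<forall>w. vanishes_below 0 w \<longrightarrow> vanishes_below 0 (?\<theta> w)"
    show "integral_vectors \<phi> \<subseteq> integral_vectors \<psi>"
    proof
      fix w assume "w \<in> integral_vectors \<phi>"
      then have "vanishes_below 0 (?\<theta> (\<phi> w))" using * by (simp add: integral_vectors_def)
      then show "w \<in> integral_vectors \<psi>" by (simp add: integral_vectors_def PPU_inverse(2)[OF \<phi>])
    qed
  next
    assume *: "integral_vectors \<phi> \<subseteq> integral_vectors \<psi>"
    show "\<forall>w. vanishes_below 0 w \<longrightarrow> vanishes_below 0 (?\<theta> w)"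
    proof (intro allI impI)
      fix w :: "'v laurent" assume "vanishes_below 0 w"
      then have "inverse_PPU \<phi> w \<in> integral_vectors \<phi>"
        by (simp add: integral_vectors_def PPU_inverse(3)[OF \<phi>])
      then show "vanishes_below 0 (?\<theta> w)" using * by (auto simp: integral_vectors_def)
    qed
  qed
  finally show ?thesis .
qed

section \<open>The bijection between pure paraunitary maps and bounded submodules\<close>

lemma subspace_wandering:
  assumes "bounded_submodule \<Lambda>"
  shows "laurent.subspace (wandering \<Lambda>)"
  using subspace_bounded_submodule[OF assms]
  by (simp add: laurent.subspace_def wandering_def const_form_add_left const_form_cscale_left)

lemma wandering_eval_one_unique:
  assumes \<Lambda>: "bounded_submodule \<Lambda>" and "u \<in> wandering \<Lambda>" "u' \<in> wandering \<Lambda>" "eval_one u = eval_one u'"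
  shows "u = u'"
proof -
  have "u - u' \<in> wandering \<Lambda>"
    using laurent.subspace_diff[OF subspace_wandering[OF \<Lambda>]] assms by blast
  moreover have "eval_one (u - u') = 0"
    using eval_one_add[of "u - u'" u'] assms by simp
  ultimately show ?thesis
    using wandering_eval_one_inj[OF \<Lambda>, of "u - u'"] by simp
qed

text \<open>As \<open>\<phi>\<close> is an isometry, the claim can be checked after applying it:
  constants are orthogonal to \<open>t V[t]\<close>.\<close>

lemma inverse_single_wandering:
  assumes \<phi>: "\<phi> \<in> PPU scale b"
  shows "inverse_PPU \<phi> (Poly_Mapping.single 0 x) \<in> wandering (integral_vectors \<phi>)"
    (is "?u \<in> _")
proof -
  have "\<beta> ?u (shift 1 w) = 0" if "w \<in> integral_vectors \<phi>" for w
  proof -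
    have "\<beta> ?u (shift 1 w) = \<beta> (\<phi> ?u) (\<phi> (shift 1 w))"
      by (simp only: PPU_const_form[OF \<phi>])
    also have "\<dots> = \<beta> (shift 1 (\<phi> w)) (Poly_Mapping.single 0 x)"
      by (simp only: PPU_inverse(3)[OF \<phi>] PPU_shift[OF \<phi>] const_form_sym)
    also have "\<dots> = 0"
      using that by (simp add: integral_vectors_def vanishes_below_def)
    finally show ?thesis .
  qed
  moreover have "?u \<in> integral_vectors \<phi>"
    by (simp add: integral_vectors_def PPU_inverse(3)[OF \<phi>] vanishes_below_def lookup_single)
  ultimately show ?thesis by (simp add: wandering_def)
qed

text \<open>The inverse of \<open>\<phi>\<close> sends a constant \<open>x\<close> to the only
  vector of \<open>U\<close> with value \<open>x\<close> at \<open>t = 1\<close>, which depends on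
  the submodule alone. Linearity over \<open>k[t,t^-1]\<close> determines the rest.\<close>

lemma integral_vectors_inj:
  assumes \<phi>: "\<phi> \<in> PPU scale b" and \<psi>: "\<psi> \<in> PPU scale b" and eq: "integral_vectors \<phi> = integral_vectors \<psi>"
  shows "\<phi> = \<psi>"
proof -
  have const: "inverse_PPU \<phi> (Poly_Mapping.single 0 x) = inverse_PPU \<psi> (Poly_Mapping.single 0 x)" for x
    by (rule wandering_eval_one_unique[OF bounded_submodule_integral_vectors[OF \<phi>]])
      (simp_all add: inverse_single_wandering \<phi> \<psi> eq eval_one_PPU PPU_inverse(1), 
        simp add: eq[symmetric] inverse_single_wandering \<phi>)
  have inv_eq: "inverse_PPU \<phi> w = inverse_PPU \<psi> w" for w :: "'v laurent"
  proof (induction w rule: laurent_induct)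
    case (single i x)
    have "inverse_PPU \<chi> (Poly_Mapping.single i x) = shift i (inverse_PPU \<chi> (Poly_Mapping.single 0 x))"
      if "\<chi> \<in> PPU scale b" for \<chi>
      using PPU_shift[OF PPU_inverse(1)[OF that], of i "Poly_Mapping.single 0 x"] by simp
    then show ?case using const \<phi> \<psi> by simp
  next
    case (add p q)
    then show ?case
      using \<phi> \<psi> by (simp add: module_hom.add[OF PPU_hom] PPU_inverse(1))
  qed (simp add: \<phi> \<psi> module_hom.zero[OF PPU_hom] PPU_inverse(1))
  show ?thesis
  proof
    fix w
    have "\<phi> w = \<psi> (inverse_PPU \<psi> (\<phi> w))" by (simp add: PPU_inverse(3)[OF \<psi>])
    also have "\<dots> = \<psi> w" by (simp add: inv_eq[symmetric] PPU_inverse(2)[OF \<phi>])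
    finally show "\<phi> w = \<psi> w" .
  qed
qed

text \<open>The map built is \<open>\<psi>\<close>, the inverse of the desired one, since its values
  on constants are prescribed: \<open>\<sigma>\<close> inverts evaluation on \<open>U\<close>, and
  \<open>\<psi>\<close> is its \<open>k[t,t^-1]\<close>-linear extension.\<close>

lemma integral_vectors_surj:
  assumes \<Lambda>: "bounded_submodule \<Lambda>"
  shows "\<exists>\<phi>\<in>PPU scale b. integral_vectors \<phi> = \<Lambda>"
proof -
  let ?U = "wandering \<Lambda>"
  note subU = subspace_wandering[OF \<Lambda>]
  obtain \<sigma> where \<sigma>: "\<And>x. \<sigma> x \<in> ?U" "\<And>x. eval_one (\<sigma> x) = x"
    using wandering_eval_one_surj[OF \<Lambda>] by metis
  have \<sigma>_eq: "\<sigma> (eval_one u) = u" if "u \<in> ?U" for u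
    by (rule wandering_eval_one_unique[OF \<Lambda>]) (simp_all add: that \<sigma>)
  have \<sigma>_add: "\<sigma> (x + y) = \<sigma> x + \<sigma> y" for x y
    by (rule wandering_eval_one_unique[OF \<Lambda>])
      (simp_all add: \<sigma> eval_one_add laurent.subspace_add[OF subU])
  have \<sigma>_scale: "\<sigma> (scale a x) = cscale a (\<sigma> x)" for a x
    by (rule wandering_eval_one_unique[OF \<Lambda>])
      (simp_all add: \<sigma> eval_one_cscale laurent.subspace_scale[OF subU])
  have \<sigma>_zero: "\<sigma> 0 = 0" using \<sigma>_add[of 0 0] by simp
  define \<psi> where "\<psi> w = (\<Sum>i\<in>Poly_Mapping.keys w. shift i (\<sigma> (Poly_Mapping.lookup w i)))" for w
  have \<psi>_superset: "\<psi> w = (\<Sum>i\<in>A. shift i (\<sigma> (Poly_Mapping.lookup w i)))"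
    if "finite A" "Poly_Mapping.keys w \<subseteq> A" for A w
    unfolding \<psi>_def using that
    by (intro sum.mono_neutral_left) (auto simp: in_keys_iff \<sigma>_zero lscale_zero_right)
  have \<psi>_single: "\<psi> (Poly_Mapping.single i x) = shift i (\<sigma> x)" for i x
    by (subst \<psi>_superset[of "{i}"]) auto
  have \<psi>_zero: "\<psi> 0 = 0" by (simp add: \<psi>_def)
  have \<psi>_add: "\<psi> (v + w) = \<psi> v + \<psi> w" for v w
  proof -
    let ?A = "Poly_Mapping.keys v \<union> Poly_Mapping.keys w"
    have "\<psi> u = (\<Sum>i\<in>?A. shift i (\<sigma> (Poly_Mapping.lookup u i)))" if "u \<in> {v, w, v + w}" for u
      using that by (intro \<psi>_superset) (auto dest: keys_add[THEN subsetD])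
    then show ?thesis
      by (simp add: lookup_add \<sigma>_add shift_add sum.distrib)
  qed
  have \<psi>_scale: "\<psi> (lscale scale p w) = lscale scale p (\<psi> w)" for p w
  proof (induction p rule: laurent_induct)
    case (single i a)
    show ?case
    proof (induction w rule: laurent_induct)
      case (single j x)
      show ?case
        by (simp add: lscale_single_single \<psi>_single \<sigma>_scale) (simp add: lscale_single_eq[of i] shift_cscale[symmetric])
    qed (simp_all add: \<psi>_zero \<psi>_add lscale_zero_right lscale_add_right)
  qed (simp_all add: \<psi>_zero \<psi>_add lscale_zero_left lscale_add_left)
  interpret m: module "lscale scale" by (rule module_lscale)
  interpret \<psi>: module_hom "lscale scale" "lscale scale" \<psi>
    by unfold_locales (rule \<psi>_add \<psi>_scale)+
  have \<psi>_form: "\<beta> (\<psi> v) (\<psi> w) = \<beta> v w" for v w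
  proof (induction v rule: laurent_induct)
    case (single i x)
    show ?case
    proof (induction w rule: laurent_induct)
      case (single j y)
      have "\<beta> (shift i (\<sigma> x)) (shift j (\<sigma> y)) = \<beta> (shift (i - j) (\<sigma> x)) (\<sigma> y)"
        by (rule const_form_shift_shift)
      then show ?case
        by (simp add: \<psi>_single wandering_orthogonal[OF \<Lambda> \<sigma>(1) \<sigma>(1)] \<sigma>(2) lookup_single when_def)
    qed (simp_all add: \<psi>_zero \<psi>_add const_form_add_right)
  qed (simp_all add: \<psi>_zero \<psi>_add const_form_add_left)
  have btilde: "btilde b (\<psi> v) (\<psi> w) = btilde b v w" for v w
    by (rule poly_mapping_eqI) (simp add: lookup_btilde_eq \<psi>_scale[symmetric] \<psi>_form)
  have "inj \<psi>"
  proof (rule injI)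
    fix v w assume "\<psi> v = \<psi> w"
    then have 0: "\<psi> (v - w) = 0" by (simp add: \<psi>.diff)
    \<comment> \<open>An isometry for an anisotropic form has no kernel.\<close>
    have "v - w = 0"
      by (rule btilde_anisotropic) (metis 0 \<psi>_form const_form_zero(2))
    then show "v = w" by simp
  qed
  have image: "\<psi> ` {w. vanishes_below 0 w} = \<Lambda>"
  proof (intro equalityI subsetI)
    fix w assume "w \<in> \<psi> ` {w. vanishes_below 0 w}"
    then obtain v where v: "w = \<psi> v" "vanishes_below 0 v" by auto
    have "shift i (\<sigma> x) \<in> \<Lambda>" if "i \<ge> 0" for i x
      using shift_mem[OF \<Lambda>] \<sigma>(1) that by (auto simp: wandering_def)
    moreover have "i \<ge> 0" if "i \<in> Poly_Mapping.keys v" for i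
      using v(2) that unfolding vanishes_below_def by (meson in_keys_iff not_less)
    ultimately show "w \<in> \<Lambda>"
      unfolding v(1) \<psi>_def by (auto intro!: laurent.subspace_sum[OF subspace_bounded_submodule[OF \<Lambda>]])
  next
    fix w assume "w \<in> \<Lambda>"
    then show "w \<in> \<psi> ` {w. vanishes_below 0 w}"
    proof (rule wandering_generates[OF \<Lambda>])
      show "?U \<subseteq> \<psi> ` {w. vanishes_below 0 w}"
      proof
        fix u assume "u \<in> ?U"
        then have "u = \<psi> (Poly_Mapping.single 0 (eval_one u))"
          by (simp add: \<psi>_single \<sigma>_eq)
        then show "u \<in> \<psi> ` {w. vanishes_below 0 w}"
          by (rule image_eqI) (simp add: vanishes_below_def lookup_single)
      qed
    next
      fix x y assume "x \<in> \<psi> ` {w. vanishes_below 0 w}" "y \<in> \<psi> ` {w. vanishes_below 0 w}"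
      then show "x + y \<in> \<psi> ` {w. vanishes_below 0 w}"
        by (auto simp: \<psi>_add[symmetric] vanishes_below_def lookup_add)
    next
      fix x assume "x \<in> \<psi> ` {w. vanishes_below 0 w}"
      then show "shift 1 x \<in> \<psi> ` {w. vanishes_below 0 w}"
        by (auto simp: \<psi>_scale[symmetric] vanishes_below_def)
    qed
  qed
  \<comment> \<open>Multiplication by \<open>t^(m - k)\<close> brings \<open>w\<close> into
    \<open>\<Lambda>\<close>, the image of \<open>V[t]\<close>; linearity allows this power of
    \<open>t\<close> to be undone.\<close>
  have "w \<in> range \<psi>" for w
  proof -
    obtain k where k: "vanishes_below k w" using vanishes_below_exists by blast
    obtain m where m: "{w. vanishes_below m w} \<subseteq> \<Lambda>"
      using \<Lambda> by (auto simp: bounded_submodule_def)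
    have "shift (m - k) w \<in> \<Lambda>" using m k by auto
    then obtain v where "shift (m - k) w = \<psi> v" using image by auto
    then have "\<psi> (shift (k - m) v) = shift (k - m) (shift (m - k) w)"
      by (simp only: \<psi>_scale)
    also have "\<dots> = w" by (subst shift_shift) simp
    finally show ?thesis by blast
  qed
  then have "surj \<psi>" by blast
  have "at_one \<psi> = id"
  proof
    fix x
    have "at_one \<psi> x = eval_one (\<psi> (Poly_Mapping.single 0 x))"
      by (simp add: at_one_def hom_coeff_def eval_one_def)
    then show "at_one \<psi> x = id x" by (simp add: \<psi>_single \<sigma>)
  qed
  then have \<psi>_PPU: "\<psi> \<in> PPU scale b"
    using \<open>inj \<psi>\<close> \<open>surj \<psi>\<close> btilde \<psi>.module_hom_axioms by (simp add: PPU_def PU_def bij_def)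
  show ?thesis
  proof (intro bexI)
    show "inverse_PPU \<psi> \<in> PPU scale b" by (rule PPU_inverse(1)[OF \<psi>_PPU])
    show "integral_vectors (inverse_PPU \<psi>) = \<Lambda>"
      unfolding image[symmetric] integral_vectors_def
      by (auto simp: PPU_inverse(2)[OF \<psi>_PPU] image_iff intro: PPU_inverse(3)[OF \<psi>_PPU, symmetric])
  qed
qed

section \<open>Intersections and sums of bounded submodules\<close>

lemma bounded_submodule_inter:
  assumes "bounded_submodule A" "bounded_submodule B"
  shows "bounded_submodule (A \<inter> B)"
proof -
  obtain m m' where "{w. vanishes_below m w} \<subseteq> A" "{w. vanishes_below m' w} \<subseteq> B"
    using assms by (auto simp: bounded_submodule_def)
  then have "{w. vanishes_below (max m m') w} \<subseteq> A \<inter> B"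
    using vanishes_below_mono by (metis (no_types, lifting) Int_subset_iff max.cobounded1 max.cobounded2 mem_Collect_eq subset_iff)
  with assms show ?thesis
    unfolding bounded_submodule_def
    by (intro conjI) (auto intro!: laurent.subspace_inter)
qed

lemma bounded_submodule_sum:
  assumes "bounded_submodule A" "bounded_submodule B"
  shows "bounded_submodule {x + y |x y. x \<in> A \<and> y \<in> B}"
  unfolding bounded_submodule_def
proof (intro conjI)
  note A = subspace_bounded_submodule[OF assms(1)] and B = subspace_bounded_submodule[OF assms(2)]
  show "laurent.subspace {x + y |x y. x \<in> A \<and> y \<in> B}"
    by (rule laurent.subspace_sums[OF A B])
  show "shift 1 ` {x + y |x y. x \<in> A \<and> y \<in> B} \<subseteq> {x + y |x y. x \<in> A \<and> y \<in> B}"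
    using assms by (fastforce simp: shift_add bounded_submodule_def)
  obtain m where "{w. vanishes_below m w} \<subseteq> A"
    using assms by (auto simp: bounded_submodule_def)
  moreover have "A \<subseteq> {x + y |x y. x \<in> A \<and> y \<in> B}"
    using laurent.subspace_0[OF B] by force
  ultimately show "\<exists>m. {w. vanishes_below m w} \<subseteq> {x + y |x y. x \<in> A \<and> y \<in> B}" by blast
  obtain l l' where l: "A \<subseteq> {w. vanishes_below l w}" "B \<subseteq> {w. vanishes_below l' w}"
    using assms by (auto simp: bounded_submodule_def)
  have "vanishes_below (min l l') (x + y)" if "x \<in> A" "y \<in> B" for x y
  proof -
    have "vanishes_below l x" "vanishes_below l' y" using l that by auto
    then show ?thesis by (simp add: vanishes_below_def lookup_add)
  qed
  then show "\<exists>l. {x + y |x y. x \<in> A \<and> y \<in> B} \<subseteq> {w. vanishes_below l w}" by blast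
qed

section \<open>The order, its suprema and infima, and right invariance\<close>

lemma PPU_order_simps [simp]:
  "carrier (PPU_order scale b) = PPU scale b" "eq (PPU_order scale b) = (=)"
  by (simp_all add: PPU_order_def)

text \<open>Antisymmetry is \<open>integral_vectors_inj\<close>; the other laws are inherited from
  inclusion.\<close>

lemma partial_order_PPU_order: "partial_order (PPU_order scale b)"
proof
  fix x y z w
  show "x \<sqsubseteq>\<^bsub>PPU_order scale b\<^esub> y \<Longrightarrow> y \<sqsubseteq>\<^bsub>PPU_order scale b\<^esub> x \<Longrightarrow>
      x \<in> carrier (PPU_order scale b) \<Longrightarrow> y \<in> carrier (PPU_order scale b) \<Longrightarrow> x .=\<^bsub>PPU_order scale b\<^esub> y"
    using integral_vectors_inj by (auto simp: le_PPU_order_iff)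
qed (auto simp: le_PPU_order_iff)

text \<open>The supremum is the element attached to the sum of the two submodules, the least
  submodule containing both.\<close>

lemma PPU_sup_exists:
  assumes \<phi>: "\<phi> \<in> PPU scale b" and \<psi>: "\<psi> \<in> PPU scale b"
  shows "\<exists>s. least (PPU_order scale b) s (Upper (PPU_order scale b) {\<phi>, \<psi>})"
proof -
  let ?S = "{x + y |x y. x \<in> integral_vectors \<phi> \<and> y \<in> integral_vectors \<psi>}"
  have "bounded_submodule ?S"
    by (intro bounded_submodule_sum bounded_submodule_integral_vectors \<phi> \<psi>)
  then obtain s where s: "s \<in> PPU scale b" "integral_vectors s = ?S"
    using integral_vectors_surj by blast
  have zero: "0 \<in> integral_vectors \<phi>" "0 \<in> integral_vectors \<psi>"
    using \<phi> \<psi> by (auto intro!: laurent.subspace_0 subspace_bounded_submodule bounded_submodule_integral_vectors)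
  have "integral_vectors \<phi> \<subseteq> ?S" "integral_vectors \<psi> \<subseteq> ?S"
    using zero by force+
  then have "s \<in> Upper (PPU_order scale b) {\<phi>, \<psi>}"
    using s \<phi> \<psi> by (auto simp: Upper_def le_PPU_order_iff all_conj_distrib)
  moreover have "s \<sqsubseteq>\<^bsub>PPU_order scale b\<^esub> u" if "u \<in> Upper (PPU_order scale b) {\<phi>, \<psi>}" for u
  proof -
    have u: "u \<in> PPU scale b" "integral_vectors \<phi> \<subseteq> integral_vectors u" "integral_vectors \<psi> \<subseteq> integral_vectors u"
      using that \<phi> \<psi> by (auto simp: Upper_def le_PPU_order_iff all_conj_distrib)
    have "?S \<subseteq> integral_vectors u"
      using u laurent.subspace_add[OF subspace_bounded_submodule[OF bounded_submodule_integral_vectors[OF u(1)]]] by blast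
    then show ?thesis using s u by (simp add: le_PPU_order_iff)
  qed
  ultimately show ?thesis
    by (auto simp: least_def Upper_def)
qed

text \<open>The infimum is the element attached to the intersection.\<close>

lemma PPU_inf_exists:
  assumes \<phi>: "\<phi> \<in> PPU scale b" and \<psi>: "\<psi> \<in> PPU scale b"
  shows "\<exists>s. greatest (PPU_order scale b) s (Lower (PPU_order scale b) {\<phi>, \<psi>})"
proof -
  have "bounded_submodule (integral_vectors \<phi> \<inter> integral_vectors \<psi>)"
    by (intro bounded_submodule_inter bounded_submodule_integral_vectors \<phi> \<psi>)
  then obtain s where s: "s \<in> PPU scale b" "integral_vectors s = integral_vectors \<phi> \<inter> integral_vectors \<psi>"
    using integral_vectors_surj by blast
  have "s \<in> Lower (PPU_order scale b) {\<phi>, \<psi>}"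
    using s \<phi> \<psi> by (auto simp: Lower_def le_PPU_order_iff)
  moreover have "u \<sqsubseteq>\<^bsub>PPU_order scale b\<^esub> s" if "u \<in> Lower (PPU_order scale b) {\<phi>, \<psi>}" for u
  proof -
    have "u \<in> PPU scale b" "u \<sqsubseteq>\<^bsub>PPU_order scale b\<^esub> \<phi>" "u \<sqsubseteq>\<^bsub>PPU_order scale b\<^esub> \<psi>"
      using that \<phi> \<psi> by (simp_all add: Lower_def)
    then show ?thesis using s \<phi> \<psi> by (simp add: le_PPU_order_iff)
  qed
  ultimately show ?thesis
    by (auto simp: greatest_def Lower_def)
qed

lemma lattice_PPU_order: "lattice (PPU_order scale b)"
proof -
  interpret partial_order "PPU_order scale b" by (rule partial_order_PPU_order)
  show ?thesis
    by unfold_locales (simp_all add: PPU_sup_exists PPU_inf_exists)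
qed

text \<open>The submodule of \<open>\<phi> \<circ> \<chi>\<close> is the preimage under
  \<open>\<chi>\<close> of that of \<open>\<phi>\<close>, and preimages preserve inclusion.\<close>

lemma PPU_order_right_invariant:
  assumes "\<phi> \<in> PPU scale b" "\<psi> \<in> PPU scale b" "\<chi> \<in> PPU scale b" "\<phi> \<sqsubseteq>\<^bsub>PPU_order scale b\<^esub> \<psi>"
  shows "\<phi> \<otimes>\<^bsub>PPU_group scale b\<^esub> \<chi> \<sqsubseteq>\<^bsub>PPU_order scale b\<^esub> \<psi> \<otimes>\<^bsub>PPU_group scale b\<^esub> \<chi>"
  using assms by (auto simp: PPU_group_simps le_PPU_order_iff PPU_comp integral_vectors_def)

end

theorem theorem3:
  fixes scale :: "'k::field \<Rightarrow> 'v::ab_group_add \<Rightarrow> 'v"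
    and Basis :: "'v set"
    and b :: "'v \<Rightarrow> 'v \<Rightarrow> 'k"
  assumes "finite_dimensional_vector_space scale Basis"
    and "symmetric_bilinear scale b"
    and "anisotropic b"
  shows "lattice (PPU_order scale b) \<and>
    (\<forall>\<phi>\<in>PPU scale b. \<forall>\<psi>\<in>PPU scale b. \<forall>\<chi>\<in>PPU scale b.
      \<phi> \<sqsubseteq>\<^bsub>PPU_order scale b\<^esub> \<psi> \<longrightarrow>
      \<phi> \<otimes>\<^bsub>PPU_group scale b\<^esub> \<chi> \<sqsubseteq>\<^bsub>PPU_order scale b\<^esub> \<psi> \<otimes>\<^bsub>PPU_group scale b\<^esub> \<chi>)"
proof -
  interpret anisotropic_space scale Basis b
    using assms by (intro anisotropic_space.intro anisotropic_space_axioms.intro)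
  show ?thesis
    using lattice_PPU_order PPU_order_right_invariant by blast
qed

end
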